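(* Let $F(w)=\mathbb{E}[f(w;\xi)]$, $w\in\mathbb{R}^d$. Assume: (1) $F$ is $\mu$-strongly convex for some $\mu>0$; (2) for every realization of $\xi$, $f(\cdot;\xi)$ is $L$-smooth, with a common constant $L>0$; (3) for every realization of $\xi$, $f(\cdot;\xi)$ is convex; and (4) shared memory is consistent with (time-dependent) delay $\tau(t)$ for the asynchronous recursion $$w_{t+1}=w_t-\eta_t\,d_{\xi_t}S^{\xi_t}_{u_t}\nabla f(\hat w_t;\xi_t),\qquad t\ge0,$$ with filter matrices $S^\xi_u$ with parameter $D$ (all as defined in the context), started from a given $w_0\in\mathbb{R}^d$. Let $w_*$ be the unique minimizer of $F$ and $N=2\,\mathbb{E}[\|\nabla f(w_*;\xi)\|^2]<\infty$. Assume $$\frac{2L\alpha D}{\mu}\le\tau(t)\le\sqrt{t\cdot L(t)},\qquad L(t)=\frac{1}{\ln t}-\frac{1}{(\ln t)^2},$$ with $\tau(t)$ monotonic increasing. Let $\eta_t=\frac{\alpha_t}{\mu(t+2\tau(t))}$ with $12\le\alpha_t\le\alpha$. Then $$\mathbb{E}[\|\hat w_{t+1}-w_*\|^2]\le\frac{4\alpha^2DN}{\mu^2}\,\frac1t+O\!\left(\frac{1}{t\ln t}\right),$$ and $\mathbb{E}[\|w_{t+1}-w_*\|^2]$ satisfies the same bound. Here $O(\cdot)$ is for $t\to\infty$, with a constant independent of $t$ (it may depend on the other data of the problem).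
   Context: $\xi$ is a random variable, $f(\cdot;\xi):\mathbb{R}^d\to\mathbb{R}$ is differentiable for each realization, $\mathbb{E}[\nabla f(w;\xi)]=\nabla F(w)$ for every fixed $w$, and $\xi_0,\xi_1,\dots$ are i.i.d. copies of $\xi$. $\|\cdot\|$ is the Euclidean norm. Strong convexity: $F(w)-F(w')\ge\langle\nabla F(w'),w-w'\rangle+\frac{\mu}{2}\|w-w'\|^2$ for all $w,w'$. $L$-smooth: $\|\nabla f(w;\xi)-\nabla f(w';\xi)\|\le L\|w-w'\|$ for all $w,w'$. Convex: $f(w;\xi)-f(w';\xi)\ge\langle\nabla f(w';\xi),w-w'\rangle$ for all $w,w'$. (The constant $L$ and the function $L(t)$ are different objects.) Filters. $D_\xi\subseteq\{1,\dots,d\}$ is the set of positions $i$ such that the $i$-th entry of $\nabla f(w;\xi)$ is non-zero for some $w$; $D_\xi$ also denotes the diagonal 0/1 matrix with ones exactly at these positions, and $|D_\xi|$ is the number of ones. $D\ge1$ is a fixed integer. For each $\xi$, $D_\xi$ is partitioned (in a way fixed a priori) into non-empty, approximately equally sized sets $S^\xi_u$, also viewed as diagonal 0/1 matrices, so $\sum_uS^\xi_u=D_\xi$: if $D\le|D_\xi|$ there are $D$ sets, each of size $\lfloor|D_\xi|/D\rfloor$ or $\lceil|D_\xi|/D\rceil$; if $D>|D_\xi|$ there are $|D_\xi|$ singletons. $d_\xi$ is the number of sets. Given $\xi_t$, the index $u_t$ is chosen uniformly among the $d_{\xi_t}$ indices, so $d_\xi\mathbb{E}[S^\xi_u\mid\xi]=D_\xi$.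 Delay. Consistency with delay $\tau(t)$ means: for all $t$, $\hat w_t$ equals $w_{t-\tau(t)}$ plus some subset of the single-entry updates made in going from $w_j$ to $w_{j+1}$, $t-\tau(t)\le j\le t-1$ (inconsistent reads and writes with atomic entry reads and updates), i.e. $$\hat w_t=w_{t-\tau(t)}-\sum_{j=t-\tau(t)}^{t-1}\eta_jd_{\xi_j}\Sigma_{t,j}S^{\xi_j}_{u_j}\nabla f(\hat w_j;\xi_j)$$ for some diagonal 0/1 matrices ("masks") $\Sigma_{t,j}$, where $t-\tau(t)$ is read as $\max\{t-\tau(t),0\}$. Let $\mathcal{F}_t$ be the $\sigma$-algebra generated by $w_0$, $\xi_0,u_0,\dots,\xi_{t-1},u_{t-1}$ and all masks $\Sigma_{s,j}$ with $s\le t$. It is assumed that $\xi_t$ is independent of $\mathcal{F}_t$ and that, conditionally on $\mathcal{F}_t$ and $\xi_t$, $u_t$ is uniformly distributed over the $d_{\xi_t}$ indices $u$ of the sets $S^{\xi_t}_u$. *)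

theory Defs
  imports "HOL-Probability.Probability"
begin

text \<open>Only meaningful where \<open>f\<close> is differentiable; there it is uniquely determined.\<close>

definition gradient :: "('v::euclidean_space \<Rightarrow> real) \<Rightarrow> 'v \<Rightarrow> 'v" where
  "gradient f w = (THE g. GDERIV f w :> g)"

definition strongly_convex :: "real \<Rightarrow> ('v::euclidean_space \<Rightarrow> real) \<Rightarrow> bool" where
  "strongly_convex \<mu> F \<longleftrightarrow>
    (\<forall>w w'. F w - F w' \<ge> gradient F w' \<bullet> (w - w') + \<mu> / 2 * (norm (w - w'))\<^sup>2)"

definition L_smooth :: "real \<Rightarrow> ('v::euclidean_space \<Rightarrow> real) \<Rightarrow> bool" where
  "L_smooth L f \<longleftrightarrow> (\<forall>w w'. norm (gradient f w - gradient f w') \<le> L * norm (w - w'))"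

definition gradient_convex :: "('v::euclidean_space \<Rightarrow> real) \<Rightarrow> bool" where
  "gradient_convex f \<longleftrightarrow> (\<forall>w w'. f w - f w' \<ge> gradient f w' \<bullet> (w - w'))"

text \<open>The set of coordinates on which \<open>\<nabla>f\<close> is not identically zero.\<close>

definition grad_support :: "(real ^ 'd \<Rightarrow> real) \<Rightarrow> 'd::finite set" where
  "grad_support f = {i. \<exists>w. gradient f w $ i \<noteq> 0}"

definition diag01 :: "'d::finite set \<Rightarrow> real ^ 'd ^ 'd" where
  "diag01 A = (\<chi> i j. if i = j \<and> i \<in> A then 1 else 0)"

text \<open>The number of filters for a support of size \<open>n\<close>. It is \<open>0\<close> exactly when the support
  is empty; in that case the update of the recursion vanishes.\<close>

definition num_filters :: "nat \<Rightarrow> nat \<Rightarrow> nat" where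
  "num_filters D n = (if D \<le> n then D else n)"

text \<open>\<open>S 0, \<dots>, S (num_filters D (card A) - 1)\<close> are distinct and form a partition
  of \<open>A\<close> into approximately equally sized blocks. Values of \<open>S\<close> at larger indices are unconstrained.\<close>

definition filter_partition :: "nat \<Rightarrow> 'd set \<Rightarrow> (nat \<Rightarrow> 'd set) \<Rightarrow> bool" where
  "filter_partition D A S \<longleftrightarrow>
    (let n = card A; m = num_filters D n in
      partition_on A (S ` {..<m}) \<and> inj_on S {..<m} \<and>
      (if D \<le> n
       then \<forall>u<m. int (card (S u)) \<in> {\<lfloor>real n / real D\<rfloor>, \<lceil>real n / real D\<rceil>}
       else \<forall>u<m. card (S u) = 1))"

definition delay_fun :: "real \<Rightarrow> real" where
  "delay_fun t = 1 / ln t - 1 / (ln t)\<^sup>2"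

text \<open>The sigma-algebra generated by \<open>w 0\<close>, by \<open>\<xi> s\<close> and \<open>u s\<close> for \<open>s < t\<close>, and by the masks
  \<open>\<Sigma> s j\<close> for \<open>s \<le> t\<close>, where \<open>j\<close> ranges over the indices for which a mask occurs in the
  read at time \<open>s\<close>. Subtraction on \<open>nat\<close> truncates, so \<open>s - \<tau> s\<close> is \<open>max (s - \<tau> s) 0\<close>.\<close>

definition history ::
  "'a measure \<Rightarrow> 'x measure \<Rightarrow> (nat \<Rightarrow> 'a \<Rightarrow> real ^ 'd) \<Rightarrow> (nat \<Rightarrow> 'a \<Rightarrow> 'x) \<Rightarrow> (nat \<Rightarrow> 'a \<Rightarrow> nat) \<Rightarrow>
   (nat \<Rightarrow> nat \<Rightarrow> 'a \<Rightarrow> 'd::finite set) \<Rightarrow> (nat \<Rightarrow> nat) \<Rightarrow> nat \<Rightarrow> 'a measure" where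
  "history M P w \<xi> u \<Sigma> \<tau> t = sigma (space M)
     ({w 0 -` A \<inter> space M | A. A \<in> sets borel} \<union>
      {\<xi> s -` A \<inter> space M | s A. s < t \<and> A \<in> sets P} \<union>
      {u s -` A \<inter> space M | s A. s < t} \<union>
      {\<Sigma> s j -` A \<inter> space M | s j A. s \<le> t \<and> j \<in> {s - \<tau> s..<s}})"

text \<open>The sigma-algebra generated by \<open>F\<close> and the random variable \<open>X\<close> with values in \<open>P\<close>.\<close>

definition adjoin :: "'a measure \<Rightarrow> ('a \<Rightarrow> 'x) \<Rightarrow> 'x measure \<Rightarrow> 'a measure" where
  "adjoin F X P = sigma (space F) (sets F \<union> {X -` A \<inter> space F | A. A \<in> sets P})"

end

theory Submission
  imports Defs
begin

text \<open>
  Write \<open>Y\<^sub>t\<close>, \<open>e\<^sub>t\<close>, \<open>Z\<^sub>t\<close> for the expected squares of the norms of \<open>w\<^sub>t - w\<^sub>*\<close>, \<open>what\<^sub>t - w\<^sub>*\<close>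
  and \<open>what\<^sub>t - w\<^sub>t\<close>. Averaging first over \<open>u\<^sub>t\<close> and then over \<open>\<xi>\<^sub>t\<close>, which is independent of the
  history, smoothness and strong convexity give
  \<open>Y\<^sub>t\<^sub>+\<^sub>1 \<le> (1 - \<mu>\<eta>\<^sub>t/2) Y\<^sub>t + O(\<eta>\<^sub>t) Z\<^sub>t + 2\<eta>\<^sub>t\<^sup>2DN\<close>. By Cauchy-Schwarz, \<open>Z\<^sub>t\<close> is at most \<open>\<tau>(t)\<close> times the
  sum of \<open>\<eta>\<^sub>j\<^sup>2 D (2L\<^sup>2 e\<^sub>j + N)\<close> over the window of the last \<open>\<tau>(t)\<close> indices, and
  \<open>e\<^sub>t \<le> 2Y\<^sub>t + 2Z\<^sub>t\<close>. As \<open>\<tau>(t)\<^sup>2 \<le> t / ln t\<close>, an induction first shows that \<open>e\<close> is bounded, hence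
  \<open>Z\<^sub>t = O(1 / (t ln t))\<close>. Since \<open>\<mu>\<eta>\<^sub>t/2 \<ge> 4/t\<close> for large \<open>t\<close>, a second induction gives
  \<open>Y\<^sub>t \<le> A/t + O(1 / (t ln t))\<close> with \<open>A = 2\<alpha>\<^sup>2DN/\<mu>\<^sup>2\<close>, and \<open>e\<^sub>t \<le> 2Y\<^sub>t + 2Z\<^sub>t\<close> costs the
  remaining factor \<open>2\<close>.
\<close>

section \<open>Smooth convex functions\<close>

text \<open>The vector representing the derivative is read off from its values on the basis.
  Uniqueness of the derivative leaves no second candidate, so the \<open>THE\<close> in
  \<open>gradient\<close> is well-defined.\<close>

lemma GDERIV_gradient:
  assumes "h differentiable (at x)"
  shows "GDERIV h x :> gradient h x"
proof -
  obtain h' where h': "(h has_derivative h') (at x)"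
    using assms by (auto simp: differentiable_def)
  then have lin: "linear h'"
    by (rule has_derivative_linear)
  have "h' = (\<lambda>v. v \<bullet> (\<Sum>b\<in>Basis. h' b *\<^sub>R b))"
  proof
    fix v
    have "h' v = h' (\<Sum>b\<in>Basis. (v \<bullet> b) *\<^sub>R b)"
      by (simp add: euclidean_representation)
    also have "\<dots> = (\<Sum>b\<in>Basis. (v \<bullet> b) * h' b)"
      using lin by (simp add: linear_sum linear_scale)
    finally show "h' v = v \<bullet> (\<Sum>b\<in>Basis. h' b *\<^sub>R b)"
      by (simp add: inner_sum_right mult.commute)
  qed
  with h' have ex: "GDERIV h x :> (\<Sum>b\<in>Basis. h' b *\<^sub>R b)"
    by (simp add: gderiv_def)
  moreover have "D = D'" if "GDERIV h x :> D" "GDERIV h x :> D'" for D D'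
  proof -
    have "(\<lambda>v. v \<bullet> D) = (\<lambda>v. v \<bullet> D')"
      using that unfolding gderiv_def by (rule has_derivative_unique)
    then show ?thesis
      by (metis inner_commute vector_eq_rdot)
  qed
  ultimately show ?thesis
    unfolding gradient_def by (metis theI)
qed

text \<open>The gap between the two sides is studied along the segment from \<open>x\<close> to
  \<open>y\<close>: \<open>p\<close> has a nonpositive derivative by Cauchy-Schwarz and smoothness,
  and the claim is \<open>p 1 \<le> p 0\<close>. No integral of the gradient along the segment is
  required.\<close>

lemma L_smooth_descent:
  assumes d: "\<And>x. h differentiable (at x)" and sm: "L_smooth L h"
  shows "h y \<le> h x + gradient h x \<bullet> (y - x) + L / 2 * (norm (y - x))\<^sup>2"
proof -
  define z where "z = y - x"
  define p where "p = (\<lambda>s. h (x + s *\<^sub>R z) - s * (gradient h x \<bullet> z) - L / 2 * s\<^sup>2 * (norm z)\<^sup>2)"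
  define p' where "p' = (\<lambda>s. z \<bullet> gradient h (x + s *\<^sub>R z) - gradient h x \<bullet> z - L * s * (norm z)\<^sup>2)"
  have der: "(p has_real_derivative p' s) (at s)" for s
  proof -
    have "((\<lambda>s. h (x + s *\<^sub>R z)) has_derivative (\<lambda>k. (k *\<^sub>R z) \<bullet> gradient h (x + s *\<^sub>R z))) (at s)"
      using GDERIV_gradient[OF d, of "x + s *\<^sub>R z"] unfolding gderiv_def
      by (rule has_derivative_compose[rotated]) (auto intro!: derivative_eq_intros)
    then have "((\<lambda>s. h (x + s *\<^sub>R z)) has_real_derivative (z \<bullet> gradient h (x + s *\<^sub>R z))) (at s)"
      unfolding has_field_derivative_def by (rule has_derivative_eq_rhs) (auto simp: mult.commute)
    then show ?thesis
      unfolding p_def p'_def by (auto intro!: derivative_eq_intros)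
  qed
  have neg: "p' s \<le> 0" if "0 \<le> s" for s
  proof -
    have "z \<bullet> gradient h (x + s *\<^sub>R z) - gradient h x \<bullet> z
        = z \<bullet> (gradient h (x + s *\<^sub>R z) - gradient h x)"
      by (simp add: inner_diff_right inner_commute)
    also have "\<dots> \<le> norm z * norm (gradient h (x + s *\<^sub>R z) - gradient h x)"
      by (rule norm_cauchy_schwarz)
    also have "\<dots> \<le> norm z * (L * norm (x + s *\<^sub>R z - x))"
      using sm unfolding L_smooth_def by (intro mult_left_mono) (blast, simp)
    finally show ?thesis
      using that by (simp add: p'_def power2_eq_square algebra_simps)
  qed
  have "p 1 \<le> p 0"
    by (rule DERIV_nonpos_imp_nonincreasing[of 0 1 p]) (auto intro!: der neg)
  then show ?thesis
    by (simp add: p_def z_def algebra_simps)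
qed

text \<open>Descent lemma for \<open>h - \<langle>\<nabla>h(x), \<cdot>\<rangle>\<close>, which is minimal at \<open>x\<close>, with a gradient step
  of length \<open>1/L\<close> from \<open>y\<close>.\<close>

lemma convex_smooth_gradient_diff:
  assumes d: "\<And>x. h differentiable (at x)" and sm: "L_smooth L h"
    and cv: "gradient_convex h" and L: "L > 0"
  shows "(norm (gradient h y - gradient h x))\<^sup>2 \<le> 2 * L * (h y - h x - gradient h x \<bullet> (y - x))"
proof -
  define q where "q = gradient h y - gradient h x"
  define z where "z = y - (1 / L) *\<^sub>R q"
  have "h x + gradient h x \<bullet> (z - x) \<le> h z"
    using cv unfolding gradient_convex_def by (smt (verit))
  also have "h z \<le> h y + gradient h y \<bullet> (z - y) + L / 2 * (norm (z - y))\<^sup>2"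
    by (rule L_smooth_descent[OF d sm])
  finally have "h x + gradient h x \<bullet> (z - x)
      \<le> h y + gradient h y \<bullet> (z - y) + L / 2 * (norm (z - y))\<^sup>2" .
  moreover have "gradient h y \<bullet> (z - y) - gradient h x \<bullet> (z - x)
      = - (1 / L) * (norm q)\<^sup>2 - gradient h x \<bullet> (y - x)"
  proof -
    have "gradient h y \<bullet> (z - y) - gradient h x \<bullet> (z - x)
        = q \<bullet> (z - y) - gradient h x \<bullet> (y - x)"
      by (simp add: q_def inner_diff_left inner_diff_right)
    then show ?thesis
      by (simp add: z_def power2_norm_eq_inner)
  qed
  moreover have "L / 2 * (norm (z - y))\<^sup>2 = (1 / (2 * L)) * (norm q)\<^sup>2"
    using L by (simp add: z_def power2_eq_square field_simps)
  ultimately have "(1 / (2 * L)) * (norm q)\<^sup>2 \<le> h y - h x - gradient h x \<bullet> (y - x)"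
    by (simp add: field_simps)
  then show ?thesis
    using L by (simp add: q_def field_simps)
qed

section \<open>Delayed recurrences\<close>

text \<open>The lag \<open>Z\<close> is controlled only through a bound \<open>B\<close> on all
  earlier \<open>e\<close>, and \<open>e\<close> in turn through \<open>Y\<close> and
  \<open>Z\<close>. A crude strong induction breaks this circle by bounding \<open>e\<close>. After
  that \<open>Z\<close> has a definite rate, and a second induction gives the sharp leading constant
  \<open>A\<close>.\<close>

lemma delayed_recurrence:
  fixes Y e Z :: "nat \<Rightarrow> real"
  assumes Y0: "\<And>t. 0 \<le> Y t" and e0: "\<And>t. 0 \<le> e t"
    and K: "0 \<le> K" and A: "0 \<le> A"
    and e: "\<And>t. e t \<le> 2 * Y t + 2 * Z t"
    and Z: "\<forall>\<^sub>F t in sequentially. \<forall>B. (\<forall>j<t. e j \<le> B) \<longrightarrow>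
        Z t \<le> K * (1 + B) / (real t * ln (real t))"
    and Y: "\<forall>\<^sub>F t in sequentially. Y (t + 1) \<le>
        (1 - 4 / real t) * Y t + K / real t * Z t + A / (real t)\<^sup>2"
  shows "\<exists>C\<ge>0. \<forall>\<^sub>F t in sequentially.
      Y t \<le> A / real t + C / (real t * ln (real t)) \<and> Z t \<le> C / (real t * ln (real t))"
proof -
  \<comment> \<open>From 4 on, the factor \<open>1 - 4 / real t\<close> is nonnegative, and
    \<open>ln (real t)\<close> is at least 1 because e is at most 3.\<close>
  have "\<forall>\<^sub>F t in sequentially. 4 \<le> (t::nat)"
    by (rule eventually_ge_at_top)
  \<comment> \<open>The threshold for the first induction: \<open>5 * K * K + A\<close> lets the
    contraction absorb the source terms, and \<open>5 * K\<close> keeps \<open>Z t\<close> below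
    \<open>B\<close>.\<close>
  moreover have "\<forall>\<^sub>F t in sequentially. 5 * K * K + A + 5 * K \<le> real t"
    using filterlim_real_sequentially by (simp add: filterlim_at_top)
  ultimately have "\<forall>\<^sub>F t in sequentially. 4 \<le> t \<and> 5 * K * K + A + 5 * K \<le> real t \<and>
    (\<forall>B. (\<forall>j<t. e j \<le> B) \<longrightarrow> Z t \<le> K * (1 + B) / (real t * ln (real t))) \<and>
    Y (t + 1) \<le> (1 - 4 / real t) * Y t + K / real t * Z t + A / (real t)\<^sup>2"
    using Z Y by eventually_elim auto
  then obtain T where T4: "\<And>t. t \<ge> T \<Longrightarrow> 4 \<le> t"
    and T5: "\<And>t. t \<ge> T \<Longrightarrow> 5 * K * K + A + 5 * K \<le> real t"
    and TZ: "\<And>t B. t \<ge> T \<Longrightarrow> (\<And>j. j < t \<Longrightarrow> e j \<le> B) \<Longrightarrow>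
        Z t \<le> K * (1 + B) / (real t * ln (real t))"
    and TY: "\<And>t. t \<ge> T \<Longrightarrow>
        Y (t + 1) \<le> (1 - 4 / real t) * Y t + K / real t * Z t + A / (real t)\<^sup>2"
    unfolding eventually_sequentially by blast
  have ln1: "1 \<le> ln (real t)" if "t \<ge> T" for t
  proof -
    have "exp 1 \<le> (3::real)" by (rule exp_le)
    also have "3 \<le> real t" using T4[OF that] by simp
    finally show ?thesis using T4[OF that] by (simp add: ln_ge_iff)
  qed
  \<comment> \<open>The sums cover the initial segment up to \<open>T\<close>, where the recurrences
    give nothing. The summand 1 ensures that \<open>1 + 4 * B\<close> is at most
    \<open>5 * B\<close> and \<open>A\<close> at most \<open>A * B\<close>.\<close>
  define B where "B = 1 + (\<Sum>s\<le>T. Y s) + (\<Sum>s\<le>T. e s)"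
  have sm: "Y s \<le> B" "e s \<le> B" if "s \<le> T" for s
  proof -
    have "Y s \<le> (\<Sum>s\<le>T. Y s)" "e s \<le> (\<Sum>s\<le>T. e s)"
      using that Y0 e0 by (auto intro!: member_le_sum)
    moreover have "0 \<le> (\<Sum>s\<le>T. Y s)" "0 \<le> (\<Sum>s\<le>T. e s)"
      using Y0 e0 by (auto intro!: sum_nonneg)
    ultimately show "Y s \<le> B" "e s \<le> B"
      unfolding B_def by auto
  qed
  have B1: "1 \<le> B"
    unfolding B_def using Y0 e0 by (simp add: sum_nonneg)
  have ZB: "Z t \<le> 5 * K * B / real t" if "t \<ge> T" "\<And>j. j < t \<Longrightarrow> e j \<le> 4 * B" for t
  proof -
    have "Z t \<le> K * (1 + 4 * B) / (real t * ln (real t))"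
      using that by (rule TZ)
    also have "\<dots> \<le> K * (5 * B) / (real t * 1)"
      using K B1 T4[OF that(1)] ln1[OF that(1)] by (intro frac_le mult_mono) auto
    finally show ?thesis by (simp add: mult.commute mult.left_commute)
  qed
  \<comment> \<open>The induction is strong because the lag looks at all earlier \<open>e\<close>.
    The factor 4 is forced by \<open>e t \<le> 2 * Y t + 2 * Z t\<close> with both
    \<open>Y t\<close> and \<open>Z t\<close> at most \<open>B\<close>.\<close>
  have bnd: "Y t \<le> B \<and> e t \<le> 4 * B" for t
  proof (induction t rule: less_induct)
    case (less t)
    show ?case
    proof (cases "t \<le> T")
      case True
      then show ?thesis using sm[OF True] B1 by auto
    next
      case False
      then obtain s where s: "t = s + 1" "s \<ge> T" by (metis Suc_eq_plus1 not_less_eq_eq old.nat.exhaust le0 Suc_le_mono)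
      have t4: "4 \<le> real s" using T4[OF s(2)] by simp
      have "Z s \<le> 5 * K * B / real s"
        using less s by (intro ZB) auto
      then have "K / real s * Z s \<le> K / real s * (5 * K * B / real s)"
        using K by (intro mult_left_mono) auto
      moreover have "(1 - 4 / real s) * Y s = Y s - 4 / real s * Y s" by (simp add: algebra_simps)
      moreover have "Y t \<le> (1 - 4 / real s) * Y s + K / real s * Z s + A / (real s)\<^sup>2"
        using TY s by simp
      \<comment> \<open>One of the four units of contraction is enough here: it yields the decrease
        \<open>B / real s\<close> that pays for the lag and noise terms.\<close>
      moreover have "(1 - 4 / real s) * Y s \<le> B - 1 / real s * B"
      proof -
        have 4: "4 \<le> real s" using T4[OF s(2)] by simp
        then have "(1 - 4 / real s) * Y s \<le> (1 - 4 / real s) * B"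
          using less s by (intro mult_left_mono) (auto simp: field_simps)
        also have "\<dots> \<le> (1 - 1 / real s) * B"
          using B1 4 by (intro mult_right_mono) (auto simp: field_simps)
        finally show ?thesis by (simp add: algebra_simps)
      qed
      moreover have "K / real s * (5 * K * B / real s) + A / (real s)\<^sup>2 \<le> 1 / real s * B"
      proof -
        have "K / real s * (5 * K * B / real s) + A / (real s)\<^sup>2
            = (5 * K * K * B + A) / (real s)\<^sup>2"
          by (simp add: power2_eq_square add_divide_distrib algebra_simps)
        also have "\<dots> \<le> (real s * B) / (real s)\<^sup>2"
        proof (intro divide_right_mono)
          have "5 * K * K * B + A * 1 \<le> 5 * K * K * B + A * B + 5 * K * B"
            using A B1 K by (intro add_increasing2 add_left_mono mult_left_mono) auto
          also have "\<dots> = (5 * K * K + A + 5 * K) * B" by (simp add: algebra_simps)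
          also have "\<dots> \<le> real s * B" using T5[OF s(2)] B1 by (intro mult_right_mono) auto
          finally show "5 * K * K * B + A \<le> real s * B" by simp
        qed simp
        finally show ?thesis using t4 by (simp add: power2_eq_square)
      qed
      ultimately have Yt: "Y t \<le> B" by linarith
      have tT: "t \<ge> T" using False by simp
      have "Z t \<le> 5 * K * B / real t"
        using less tT by (intro ZB) auto
      also have "\<dots> \<le> B"
      proof -
        have "5 * K \<le> real t" using T5[OF tT] A K by (smt (verit) mult_nonneg_nonneg)
        then have "5 * K * B \<le> real t * B" using B1 by (intro mult_right_mono) auto
        then show ?thesis using T4[OF tT] by (simp add: field_simps)
      qed
      finally have "Z t \<le> B" .
      then show ?thesis using e[of t] Yt by linarith
    qed
  qed
  define C1 where "C1 = K * (1 + 4 * B)"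
  \<comment> \<open>The three summands serve, in order, the bound on the lag, the lag term in the
    recurrence for \<open>Y\<close>, and the start of the second induction at
    \<open>T\<close>.\<close>
  define C where "C = C1 + K * C1 + Y T * (real T * ln (real T))"
  have C1: "0 \<le> C1" using K B1 by (simp add: C1_def)
  have CT: "0 \<le> Y T * (real T * ln (real T))"
    using Y0 T4[of T] by simp
  have CC: "0 \<le> C" "C1 \<le> C" "K * C1 \<le> C" "Y T * (real T * ln (real T)) \<le> C"
    using C1 K CT by (auto simp: C_def)
  have Zf: "Z t \<le> C1 / (real t * ln (real t))" if "t \<ge> T" for t
    unfolding C1_def by (rule TZ[OF that]) (use bnd in auto)
  \<comment> \<open>The remainder \<open>C / (t ln t)\<close> decays slowly enough to survive a
    contraction by \<open>1 - 3/t\<close>. Indeed \<open>(1 - 3/t)(t + 1) \<le> t - 2\<close> and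
    \<open>ln (t + 1) \<le> ln t + 1/t\<close>, and the product of the right-hand sides is
    \<open>t ln t - 2 ln t + 1 - 2/t\<close>, which is at most \<open>t ln t\<close> since
    \<open>ln t \<ge> 1\<close>.\<close>
  have step: "C / (real t * ln (real t)) * (1 - 3 / real t) \<le> C / (real (t+1) * ln (real (t+1)))"
    if "t \<ge> T" for t
  proof -
    have t4: "4 \<le> real t" using T4[OF that] by simp
    have l: "1 \<le> ln (real t)" by (rule ln1[OF that])
    have l': "0 < ln (1 + real t)" using l t4 by simp
    have "ln (real t + 1) \<le> ln (real t) + 1 / real t"
    proof -
      have "real t + 1 = real t * (1 + 1 / real t)"
        using t4 by (simp add: field_simps)
      then have "ln (real t + 1) = ln (real t) + ln (1 + 1 / real t)"
        using t4 by (simp only:) (rule ln_mult_pos, auto intro!: add_pos_pos)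
      also have "ln (1 + 1 / real t) \<le> 1 / real t"
        using t4 by (intro ln_add_one_self_le_self) auto
      finally show ?thesis by simp
    qed
    then have "(1 - 3 / real t) * (real t + 1) * ln (real t + 1)
      \<le> (1 - 3 / real t) * (real t + 1) * (ln (real t) + 1 / real t)"
      using t4 by (intro mult_left_mono mult_nonneg_nonneg) auto
    also have "(1 - 3 / real t) * (real t + 1) \<le> real t - 2"
      using t4 by (simp add: field_simps)
    then have "(1 - 3 / real t) * (real t + 1) * (ln (real t) + 1 / real t)
      \<le> (real t - 2) * (ln (real t) + 1 / real t)"
      using t4 l by (intro mult_right_mono) (auto intro!: add_nonneg_nonneg)
    also have "\<dots> = real t * ln (real t) - 2 * ln (real t) + (1 - 2 / real t)"
      using t4 by (simp add: field_simps)
    also have "\<dots> \<le> real t * ln (real t)"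
      using l t4 by (smt (verit) divide_nonneg_nonneg)
    finally have main: "(1 - 3 / real t) * (real t + 1) * ln (real t + 1) \<le> real t * ln (real t)" .
    have "(1 - 3 / real t) / (real t * ln (real t)) \<le> 1 / (real (t+1) * ln (real (t+1)))"
      using main t4 l l' by (simp add: divide_le_eq le_divide_eq mult.assoc add.commute)
    then have "C * ((1 - 3 / real t) / (real t * ln (real t))) \<le> C * (1 / (real (t+1) * ln (real (t+1))))"
      using CC(1) by (rule mult_left_mono)
    then show ?thesis by simp
  qed
  have Yf: "Y t \<le> A / real t + C / (real t * ln (real t))" if "t \<ge> T" for t
    using that
  proof (induction t rule: nat_induct_at_least)
    case base
    have "real T > 0" "ln (real T) > 0" using T4[of T] by auto
    then have "Y T \<le> C / (real T * ln (real T))"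
      using CC(4) by (simp add: field_simps)
    moreover have "0 \<le> A / real T" using A by simp
    ultimately show ?case by linarith
  next
    case (Suc t)
    have t4: "4 \<le> real t" using T4[OF Suc(1)] by simp
    have l: "1 \<le> ln (real t)" by (rule ln1[OF Suc(1)])
    show ?case
    proof -
      have pos: "0 \<le> A / real (Suc t) + C / (real (Suc t) * ln (real (Suc t)))"
        using A CC(1) by simp
      have a: "A / real t * (1 - 4 / real t) + A / (real t)\<^sup>2 \<le> A / real (Suc t)"
      proof -
        have "1 / real t * (1 - 4 / real t) + 1 / (real t)\<^sup>2 \<le> 1 / real (Suc t)"
          using t4 by (simp add: power2_eq_square field_simps)
        then have "A * (1 / real t * (1 - 4 / real t) + 1 / (real t)\<^sup>2) \<le> A * (1 / real (Suc t))"
          using A by (rule mult_left_mono)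
        then show ?thesis by (simp add: algebra_simps)
      qed
      have "K / real t * Z t \<le> K / real t * (C1 / (real t * ln (real t)))"
        using Zf[OF Suc(1)] K by (intro mult_left_mono) auto
      also have "\<dots> = K * C1 / (real t * ln (real t)) * (1 / real t)" by simp
      also have "\<dots> \<le> C / (real t * ln (real t)) * (1 / real t)"
        using CC l t4 by (intro mult_right_mono divide_right_mono) auto
      finally have k: "K / real t * Z t \<le> C / (real t * ln (real t)) * (1 / real t)" .
      \<comment> \<open>One unit of the contraction pays for the lag term; the remaining three are
        what \<open>step\<close> requires.\<close>
      have sp: "C / (real t * ln (real t)) * (1 - 4 / real t) + C / (real t * ln (real t)) * (1 / real t)
         = C / (real t * ln (real t)) * (1 - 3 / real t)"
        using t4 by (simp add: field_simps)
      have y: "(1 - 4 / real t) * Y t \<le> (A / real t + C / (real t * ln (real t))) * (1 - 4 / real t)"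
        using t4 Suc(2) by (subst mult.commute, intro mult_right_mono) auto
      have Y': "Y (Suc t) \<le> (1 - 4 / real t) * Y t + K / real t * Z t + A / (real t)\<^sup>2"
        using TY[OF Suc(1)] by simp
      show ?thesis
      proof -
        have "(A / real t + C / (real t * ln (real t))) * (1 - 4 / real t)
          = A / real t * (1 - 4 / real t) + C / (real t * ln (real t)) * (1 - 4 / real t)"
          by (rule distrib_right)
        then show ?thesis
          using Y' y k sp a step[OF Suc(1)] unfolding Suc_eq_plus1 by linarith
      qed
    qed
  qed
  show ?thesis
  proof (intro exI conjI eventually_sequentiallyI)
    show "0 \<le> C" by fact
    fix t assume t: "T \<le> t"
    show "Y t \<le> A / real t + C / (real t * ln (real t))" by (rule Yf[OF t])
    have "C1 / (real t * ln (real t)) \<le> C / (real t * ln (real t))"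
      using CC T4[OF t] by (intro divide_right_mono) auto
    then show "Z t \<le> C / (real t * ln (real t))" using Zf[OF t] by linarith
  qed
qed

section \<open>Filters\<close>

lemma diag01_mult_vec: "diag01 A *v v = (\<chi> i. if i \<in> A then v $ i else 0)"
proof (subst vec_eq_iff, intro allI)
  fix i
  have "(diag01 A *v v) $ i = (\<Sum>j\<in>UNIV. if i = j then (if i \<in> A then v $ j else 0) else 0)"
    by (simp add: matrix_vector_mult_def diag01_def if_distrib[of "\<lambda>x. x * _"] cong: if_cong)
  then show "(diag01 A *v v) $ i = (\<chi> i. if i \<in> A then v $ i else 0) $ i"
    by simp
qed

lemma norm_diag01_mult_vec_le: "norm (diag01 A *v v) \<le> norm v"
  by (rule norm_le_componentwise_cart) (simp add: diag01_mult_vec)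

lemma norm_diff_diag01_mult_vec_le: "norm (v - diag01 A *v v) \<le> norm v"
  by (rule norm_le_componentwise_cart) (simp add: diag01_mult_vec)

lemma norm_power2_vec: "(norm (v :: real ^ 'd))\<^sup>2 = (\<Sum>i\<in>UNIV. (v $ i)\<^sup>2)"
  unfolding power2_norm_eq_inner inner_vec_def by (simp add: power2_eq_square)

text \<open>A coordinate of \<open>A\<close> lies in exactly one block, and injectivity of
  \<open>S\<close> on the index range turns this into exactly one index, so nothing is counted
  twice.\<close>

lemma filter_partition_sum:
  fixes S :: "nat \<Rightarrow> 'd::finite set" and c :: "'d \<Rightarrow> real"
  assumes "filter_partition D A S"
  shows "(\<Sum>k<num_filters D (card A). if i \<in> S k then c i else 0) = (if i \<in> A then c i else 0)"
proof -
  define m where "m = num_filters D (card A)"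
  have part: "partition_on A (S ` {..<m})" and inj: "inj_on S {..<m}"
    using assms by (auto simp: filter_partition_def m_def Let_def)
  show ?thesis
  proof (cases "i \<in> A")
    case True
    then obtain k where k: "k < m" "i \<in> S k"
      using part by (auto simp: partition_on_def)
    have uniq: "k' = k" if "k' < m" "i \<in> S k'" for k'
    proof -
      have "S k' = S k"
        using disjointD[OF partition_onD2[OF part], of "S k'" "S k"] k that by auto
      then show ?thesis
        using inj_onD[OF inj] k that by blast
    qed
    have "(\<Sum>k'<m. if i \<in> S k' then c i else 0) = (\<Sum>k'<m. if k' = k then c i else 0)"
      using k by (intro sum.cong) (auto dest: uniq)
    then show ?thesis
      using True k by (simp add: m_def)
  next
    case False
    then have "i \<notin> S k" if "k < m" for k
      using part that by (auto simp: partition_on_def)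
    then show ?thesis
      using False by (simp add: m_def)
  qed
qed

lemma filter_partition_sum_diag01:
  assumes "filter_partition D (grad_support h) S"
  shows "(\<Sum>k<num_filters D (card (grad_support h)). diag01 (S k) *v gradient h v) = gradient h v"
proof -
  have "gradient h v $ i = 0" if "i \<notin> grad_support h" for i
    using that by (auto simp: grad_support_def)
  then show ?thesis
    by (simp add: vec_eq_iff diag01_mult_vec filter_partition_sum[OF assms])
qed

text \<open>Pythagoras: the blocks use disjoint coordinates, and the gradient vanishes outside its
  support. This is why filtering costs a factor \<open>D\<close> and not \<open>D^2\<close> in
  second moments.\<close>

lemma filter_partition_sum_norm_diag01:
  assumes "filter_partition D (grad_support h) S"
  shows "(\<Sum>k<num_filters D (card (grad_support h)). (norm (diag01 (S k) *v gradient h v))\<^sup>2)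
    = (norm (gradient h v))\<^sup>2"
proof -
  have "gradient h v $ i = 0" if "i \<notin> grad_support h" for i
    using that by (auto simp: grad_support_def)
  then have "(\<Sum>i\<in>UNIV. if i \<in> grad_support h then (gradient h v $ i)\<^sup>2 else 0)
      = (\<Sum>i\<in>UNIV. (gradient h v $ i)\<^sup>2)"
    by (intro sum.cong) auto
  moreover have "((diag01 (S k) *v gradient h v) $ i)\<^sup>2 = (if i \<in> S k then (gradient h v $ i)\<^sup>2 else 0)"
    for i k
    by (simp add: diag01_mult_vec)
  ultimately show ?thesis
    unfolding norm_power2_vec by (subst sum.swap)
      (simp add: filter_partition_sum[OF assms, of _ "\<lambda>i. (gradient h v $ i)\<^sup>2"])
qed

section \<open>Measurability and square integrability\<close>

text \<open>A random filter takes finitely many values, and for each fixed value the map is linear,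
  hence continuous.\<close>

lemma borel_measurable_diag01_mult_vec [measurable]:
  fixes B :: "'a \<Rightarrow> 'd::finite set"
  assumes B: "B \<in> measurable M (count_space UNIV)" and X: "X \<in> borel_measurable M"
  shows "(\<lambda>x. diag01 (B x) *v X x) \<in> borel_measurable M"
proof -
  have "(\<lambda>x. diag01 C *v X x) \<in> borel_measurable M" for C
    using X by (rule borel_measurable_continuous_on[rotated])
      (rule linear_continuous_on[OF matrix_vector_mul_bounded_linear])
  then show ?thesis
    by (rule measurable_compose_countable'[where I = UNIV, OF _ B]) auto
qed

text \<open>A Caratheodory function is jointly measurable: it is the limit of its compositions with
  the roundings to the grids of mesh \<open>1/(n+1)\<close>, each of which takes countably many values.\<close>

lemma borel_measurable_Caratheodory:
  fixes G :: "real ^ 'd::finite \<Rightarrow> 'x \<Rightarrow> 'b::metric_space"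
  assumes meas: "\<And>v. G v \<in> borel_measurable P"
    and cont: "\<And>x v. x \<in> space P \<Longrightarrow> isCont (\<lambda>v. G v x) v"
  shows "(\<lambda>p. G (fst p) (snd p)) \<in> borel_measurable (borel \<Otimes>\<^sub>M P)"
proof -
  define r :: "nat \<Rightarrow> real ^ 'd \<Rightarrow> int ^ 'd" where "r = (\<lambda>n v. \<chi> i. \<lfloor>real (Suc n) * v $ i\<rfloor>)"
  define q :: "nat \<Rightarrow> int ^ 'd \<Rightarrow> real ^ 'd" where "q = (\<lambda>n k. \<chi> i. real_of_int (k $ i) / real (Suc n))"
  have r: "r n \<in> measurable borel (count_space UNIV)" for n
  proof (subst measurable_count_space_eq_countable)
    show "countable (UNIV :: (int ^ 'd) set)" by simp
    have "r n -` {k} \<inter> space borel = {v \<in> space borel. \<forall>i\<in>UNIV. \<lfloor>real (Suc n) * v $ i\<rfloor> = k $ i}" for k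
      by (auto simp: r_def vec_eq_iff)
    moreover have "{v \<in> space borel. \<forall>i\<in>UNIV. \<lfloor>real (Suc n) * v $ i\<rfloor> = k $ i} \<in> sets borel" for k
      by measurable
    ultimately show "r n \<in> space borel \<rightarrow> UNIV \<and> (\<forall>a\<in>UNIV. r n -` {a} \<inter> space borel \<in> sets borel)"
      by simp
  qed
  have lim: "(\<lambda>n. q n (r n v)) \<longlonglongrightarrow> v" for v
  proof (rule vec_tendstoI)
    fix i
    have "(\<lambda>n. 1 / real (Suc n)) \<longlonglongrightarrow> 0"
      using LIMSEQ_inverse_real_of_nat by (simp add: inverse_eq_divide)
    then have "(\<lambda>n. q n (r n v) $ i - v $ i) \<longlonglongrightarrow> 0"
    proof (rule Lim_null_comparison[rotated], intro always_eventually allI)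
      fix n
      have "q n (r n v) $ i - v $ i = (\<lfloor>real (Suc n) * v $ i\<rfloor> - real (Suc n) * v $ i) / real (Suc n)"
        by (simp add: q_def r_def field_simps)
      moreover have "\<bar>\<lfloor>real (Suc n) * v $ i\<rfloor> - real (Suc n) * v $ i\<bar> \<le> 1"
        by linarith
      ultimately show "norm (q n (r n v) $ i - v $ i) \<le> 1 / real (Suc n)"
        by (simp add: divide_le_eq abs_divide del: of_nat_Suc)
    qed
    then show "(\<lambda>n. q n (r n v) $ i) \<longlonglongrightarrow> v $ i"
      by (simp add: LIM_zero_iff)
  qed
  show ?thesis
  proof (rule borel_measurable_LIMSEQ_metric)
    fix n
    have "(\<lambda>p. G (q n k) (snd p)) \<in> borel_measurable (borel \<Otimes>\<^sub>M P)" for k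
      using meas by measurable
    moreover have "(\<lambda>p. r n (fst p)) \<in> measurable (borel \<Otimes>\<^sub>M P) (count_space UNIV)"
      using r by measurable
    ultimately show "(\<lambda>p. G (q n (r n (fst p))) (snd p)) \<in> borel_measurable (borel \<Otimes>\<^sub>M P)"
      by (rule measurable_compose_countable)
  next
    fix p :: "(real ^ 'd) \<times> 'x" assume "p \<in> space (borel \<Otimes>\<^sub>M P)"
    then have "snd p \<in> space P" by (simp add: space_pair_measure mem_Times_iff)
    then show "(\<lambda>n. G (q n (r n (fst p))) (snd p)) \<longlonglongrightarrow> G (fst p) (snd p)"
      using isCont_tendsto_compose[OF cont lim] by blast
  qed
qed

definition square_integrable :: "'a measure \<Rightarrow> ('a \<Rightarrow> 'v::euclidean_space) \<Rightarrow> bool" where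
  "square_integrable M X \<longleftrightarrow> X \<in> borel_measurable M \<and> integrable M (\<lambda>x. (norm (X x))\<^sup>2)"

lemma square_integrable_bound:
  assumes "square_integrable M X" "Y \<in> borel_measurable M"
    and "\<And>x. x \<in> space M \<Longrightarrow> norm (Y x) \<le> c * norm (X x)"
  shows "square_integrable M Y"
proof -
  have "integrable M (\<lambda>x. (norm (Y x))\<^sup>2)"
  proof (rule Bochner_Integration.integrable_bound)
    show "integrable M (\<lambda>x. c\<^sup>2 * (norm (X x))\<^sup>2)"
      using assms by (simp add: square_integrable_def)
    have "(norm (Y x))\<^sup>2 \<le> (c * norm (X x))\<^sup>2" if "x \<in> space M" for x
      using assms(3)[OF that] by (intro power_mono) auto
    then show "AE x in M. norm ((norm (Y x))\<^sup>2) \<le> norm (c\<^sup>2 * (norm (X x))\<^sup>2)"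
      by (intro AE_I2) (simp add: power_mult_distrib)
    show "(\<lambda>x. (norm (Y x))\<^sup>2) \<in> borel_measurable M"
      using assms by measurable
  qed
  with assms show ?thesis by (simp add: square_integrable_def)
qed

lemma norm_add_power2_le: "(norm (a + b))\<^sup>2 \<le> 2 * (norm a)\<^sup>2 + 2 * (norm (b :: 'v::real_inner))\<^sup>2"
proof -
  have "(norm (a + b))\<^sup>2 + (norm (a - b))\<^sup>2 = 2 * (norm a)\<^sup>2 + 2 * (norm b)\<^sup>2"
    by (simp add: power2_norm_eq_inner inner_simps inner_commute)
  moreover have "0 \<le> (norm (a - b))\<^sup>2" by simp
  ultimately show ?thesis by linarith
qed

lemma square_integrable_add:
  assumes "square_integrable M X" "square_integrable M Y"
  shows "square_integrable M (\<lambda>x. X x + Y x)"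
proof -
  have [measurable]: "X \<in> borel_measurable M" "Y \<in> borel_measurable M"
    using assms by (auto simp: square_integrable_def)
  have "integrable M (\<lambda>x. (norm (X x + Y x))\<^sup>2)"
  proof (rule Bochner_Integration.integrable_bound)
    show "integrable M (\<lambda>x. 2 * (norm (X x))\<^sup>2 + 2 * (norm (Y x))\<^sup>2)"
      using assms by (simp add: square_integrable_def)
    show "AE x in M. norm ((norm (X x + Y x))\<^sup>2) \<le> norm (2 * (norm (X x))\<^sup>2 + 2 * (norm (Y x))\<^sup>2)"
      using norm_add_power2_le by (intro AE_I2) auto
  qed measurable
  then show ?thesis by (simp add: square_integrable_def)
qed

lemma square_integrable_scaleR:
  assumes "square_integrable M X"
  shows "square_integrable M (\<lambda>x. c *\<^sub>R X x)"
  using assms by (auto simp: square_integrable_def power_mult_distrib)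

lemma square_integrable_diff:
  assumes "square_integrable M X" "square_integrable M Y"
  shows "square_integrable M (\<lambda>x. X x - Y x)"
  using square_integrable_add[OF assms(1) square_integrable_scaleR[OF assms(2), of "-1"]] by simp

lemma square_integrable_sum:
  assumes "\<And>j. j \<in> J \<Longrightarrow> square_integrable M (X j)"
  shows "square_integrable M (\<lambda>x. \<Sum>j\<in>J. X j x)"
  using assms
proof (induction J rule: infinite_finite_induct)
  case (insert a J)
  then show ?case by (simp add: square_integrable_add)
qed (auto simp: square_integrable_def)

lemma square_integrable_inner:
  assumes "square_integrable M X" "square_integrable M Y"
  shows "integrable M (\<lambda>x. X x \<bullet> Y x)"
proof (rule Bochner_Integration.integrable_bound)
  show "integrable M (\<lambda>x. (norm (X x))\<^sup>2 + (norm (Y x))\<^sup>2)"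
    using assms by (simp add: square_integrable_def)
  show "(\<lambda>x. X x \<bullet> Y x) \<in> borel_measurable M"
    using assms by (auto simp: square_integrable_def)
  have "\<bar>X x \<bullet> Y x\<bar> \<le> (norm (X x))\<^sup>2 + (norm (Y x))\<^sup>2" for x
  proof -
    have "\<bar>X x \<bullet> Y x\<bar> \<le> norm (X x) * norm (Y x)" by (rule Cauchy_Schwarz_ineq2)
    also have "\<dots> \<le> (norm (X x))\<^sup>2 + (norm (Y x))\<^sup>2"
      using sum_squares_bound[of "norm (X x)" "norm (Y x)"]
        mult_nonneg_nonneg[OF norm_ge_zero norm_ge_zero, of "X x" "Y x"] by linarith
    finally show ?thesis .
  qed
  then show "AE x in M. norm (X x \<bullet> Y x) \<le> norm ((norm (X x))\<^sup>2 + (norm (Y x))\<^sup>2)"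
    by (intro AE_I2) auto
qed

lemma norm_sum_power2_le:
  "(norm (\<Sum>j\<in>J. X j))\<^sup>2 \<le> real (card J) * (\<Sum>j\<in>J. (norm (X j))\<^sup>2)"
proof -
  have "(norm (\<Sum>j\<in>J. X j))\<^sup>2 \<le> (\<Sum>j\<in>J. norm (X j))\<^sup>2"
    by (intro power_mono norm_sum) auto
  also have "\<dots> \<le> real (card J) * (\<Sum>j\<in>J. (norm (X j))\<^sup>2)"
    using sum_squared_le_sum_of_squares[of "\<lambda>j. norm (X j)" J] by (simp add: mult.commute)
  finally show ?thesis .
qed

section \<open>Asynchronous stochastic gradient descent\<close>

text \<open>The step sizes enter through two bounds, nonnegativity and
  \<open>1 / (4 * L * real D)\<close>; their decay is supplied in \<open>asymptotic_bounds\<close>.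
  The upper bound is what allows the second moment of an update to be absorbed by its descent. The
  parameters \<open>g\<close> and \<open>d\<xi>\<close> come with defining equations, so that they
  match the names defined in the theorem.\<close>

locale hogwild = M: prob_space M + P: prob_space P
  for M :: "'a measure" and P :: "'x measure" +
  fixes f :: "real ^ 'd::finite \<Rightarrow> 'x \<Rightarrow> real" and F :: "real ^ 'd \<Rightarrow> real"
    and S :: "'x \<Rightarrow> nat \<Rightarrow> 'd set" and D :: nat
    and \<xi> :: "nat \<Rightarrow> 'a \<Rightarrow> 'x" and u :: "nat \<Rightarrow> 'a \<Rightarrow> nat"
    and \<Sigma> :: "nat \<Rightarrow> nat \<Rightarrow> 'a \<Rightarrow> 'd set"
    and w what :: "nat \<Rightarrow> 'a \<Rightarrow> real ^ 'd" and w0 wstar :: "real ^ 'd"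
    and \<tau> :: "nat \<Rightarrow> nat" and \<eta> :: "nat \<Rightarrow> real" and \<mu> L N :: real
    and g :: "real ^ 'd \<Rightarrow> 'x \<Rightarrow> real ^ 'd" and d\<xi> :: "'x \<Rightarrow> nat"
  assumes g_def: "g = (\<lambda>v x. gradient (\<lambda>v'. f v' x) v)"
    and d\<xi>_def: "d\<xi> = (\<lambda>x. num_filters D (card (grad_support (\<lambda>v. f v x))))"
    and f_diff: "\<And>x v. x \<in> space P \<Longrightarrow> (\<lambda>v'. f v' x) differentiable (at v)"
    and f_int: "\<And>v. integrable P (f v)"
    and F_def: "\<And>v. F v = (\<integral>x. f v x \<partial>P)"
    and g_int: "\<And>v. integrable P (g v)"
    and g_unbiased: "\<And>v. (\<integral>x. g v x \<partial>P) = gradient F v"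
    and mu_pos: "\<mu> > 0" and F_sc: "strongly_convex \<mu> F"
    and L_pos: "L > 0" and f_smooth: "\<And>x. x \<in> space P \<Longrightarrow> L_smooth L (\<lambda>v. f v x)"
    and f_convex: "\<And>x. x \<in> space P \<Longrightarrow> gradient_convex (\<lambda>v. f v x)"
    and minimizer: "\<And>v. F wstar \<le> F v"
    and N_fin: "integrable P (\<lambda>x. (norm (g wstar x))\<^sup>2)"
    and N_def: "N = 2 * (\<integral>x. (norm (g wstar x))\<^sup>2 \<partial>P)"
    and D_ge1: "D \<ge> 1"
    and S_part: "\<And>x. x \<in> space P \<Longrightarrow> filter_partition D (grad_support (\<lambda>v. f v x)) (S x)"
    and S_meas: "\<And>k. (\<lambda>x. S x k) \<in> measurable P (count_space UNIV)"
    and xi_meas: "\<And>t. \<xi> t \<in> measurable M P"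
    and xi_distr: "\<And>t. distr M P (\<xi> t) = P"
    and u_meas: "\<And>t. u t \<in> measurable M (count_space UNIV)"
    and mask_meas: "\<And>t j. j \<in> {t - \<tau> t..<t} \<Longrightarrow> \<Sigma> t j \<in> measurable M (count_space UNIV)"
    and xi_indep: "\<And>t. M.indep_set
        (sets (history M P w \<xi> u \<Sigma> \<tau> t)) {\<xi> t -` A \<inter> space M | A. A \<in> sets P}"
    and u_unif: "\<And>t k. AE \<omega> in M. k < d\<xi> (\<xi> t \<omega>) \<longrightarrow>
        real_cond_exp M (adjoin (history M P w \<xi> u \<Sigma> \<tau> t) (\<xi> t) P)
          (indicator {\<omega> \<in> space M. u t \<omega> = k}) \<omega> = 1 / real (d\<xi> (\<xi> t \<omega>))"
    and w_0: "\<And>\<omega>. \<omega> \<in> space M \<Longrightarrow> w 0 \<omega> = w0"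
    and w_Suc: "\<And>t \<omega>. \<omega> \<in> space M \<Longrightarrow> w (t + 1) \<omega> = w t \<omega> -
        (\<eta> t * real (d\<xi> (\<xi> t \<omega>))) *\<^sub>R (diag01 (S (\<xi> t \<omega>) (u t \<omega>)) *v g (what t \<omega>) (\<xi> t \<omega>))"
    and consistent: "\<And>t \<omega>. \<omega> \<in> space M \<Longrightarrow> what t \<omega> = w (t - \<tau> t) \<omega> -
        (\<Sum>j\<in>{t - \<tau> t..<t}. (\<eta> j * real (d\<xi> (\<xi> j \<omega>))) *\<^sub>R
          (diag01 (\<Sigma> t j \<omega>) *v (diag01 (S (\<xi> j \<omega>) (u j \<omega>)) *v g (what j \<omega>) (\<xi> j \<omega>))))"
    and eta_nonneg: "\<And>t. 0 \<le> \<eta> t"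
    and eta_small: "\<And>t. \<eta> t \<le> 1 / (4 * L * real D)"
begin

abbreviation "hist \<equiv> history M P w \<xi> u \<Sigma> \<tau>"

section \<open>Gradient estimates and one step in expectation\<close>

lemma d_le_D: "d\<xi> x \<le> D"
  by (simp add: d\<xi>_def num_filters_def)

lemma g_lipschitz: "x \<in> space P \<Longrightarrow> norm (g v x - g v' x) \<le> L * norm (v - v')"
  using f_smooth by (auto simp: L_smooth_def g_def)

lemma g_meas [measurable]: "g v \<in> borel_measurable P"
  using g_int by (rule borel_measurable_integrable)

lemma g_norm2_le:
  assumes "x \<in> space P"
  shows "(norm (g v x))\<^sup>2 \<le> 2 * L\<^sup>2 * (norm (v - v'))\<^sup>2 + 2 * (norm (g v' x))\<^sup>2"
proof -
  have "(norm (g v x))\<^sup>2 = (norm ((g v x - g v' x) + g v' x))\<^sup>2" by simp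
  also have "\<dots> \<le> 2 * (norm (g v x - g v' x))\<^sup>2 + 2 * (norm (g v' x))\<^sup>2"
    by (rule norm_add_power2_le)
  also have "(norm (g v x - g v' x))\<^sup>2 \<le> (L * norm (v - v'))\<^sup>2"
    using g_lipschitz[OF assms] by (intro power_mono) auto
  finally show ?thesis by (simp add: power_mult_distrib)
qed

lemma g_norm2_int: "integrable P (\<lambda>x. (norm (g v x))\<^sup>2)"
proof (rule Bochner_Integration.integrable_bound)
  show "integrable P (\<lambda>x. 2 * L\<^sup>2 * (norm (v - wstar))\<^sup>2 + 2 * (norm (g wstar x))\<^sup>2)"
    using N_fin by simp
  show "AE x in P. norm ((norm (g v x))\<^sup>2)
      \<le> norm (2 * L\<^sup>2 * (norm (v - wstar))\<^sup>2 + 2 * (norm (g wstar x))\<^sup>2)"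
    using g_norm2_le by (intro AE_I2) simp
qed measurable

lemma f_descent:
  "x \<in> space P \<Longrightarrow> f v x \<le> f v' x + g v' x \<bullet> (v - v') + L / 2 * (norm (v - v'))\<^sup>2"
  unfolding g_def using L_smooth_descent[OF f_diff f_smooth] by simp

text \<open>Smoothness passes to \<open>F\<close> by integrating the descent inequality of the
  realizations; \<open>g_unbiased\<close> identifies the averaged linear term.\<close>

lemma F_descent: "F v \<le> F v' + gradient F v' \<bullet> (v - v') + L / 2 * (norm (v - v'))\<^sup>2"
proof -
  have "F v \<le> (\<integral>x. f v' x + g v' x \<bullet> (v - v') + L / 2 * (norm (v - v'))\<^sup>2 \<partial>P)"
    unfolding F_def using f_int g_int f_descent by (intro integral_mono) auto
  then show ?thesis
    using f_int g_int by (simp add: F_def g_unbiased[symmetric] P.prob_space)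
qed

text \<open>By the descent inequality, a gradient step of length \<open>1 / L\<close> from the
  minimizer would lower \<open>F\<close> by the squared gradient norm over
  \<open>2 * L\<close>.\<close>

lemma gradient_F_wstar: "gradient F wstar = 0"
proof -
  define z where "z = - (1 / L) *\<^sub>R gradient F wstar"
  have "F wstar \<le> F (wstar + z)" by (rule minimizer)
  also have "\<dots> \<le> F wstar + (gradient F wstar \<bullet> z + L / 2 * (norm z)\<^sup>2)"
    using F_descent[of "wstar + z" wstar] by simp
  also have "gradient F wstar \<bullet> z + L / 2 * (norm z)\<^sup>2 = - (1 / (2 * L)) * (norm (gradient F wstar))\<^sup>2"
  proof -
    have 1: "gradient F wstar \<bullet> z = - (1 / L) * (norm (gradient F wstar))\<^sup>2"
      by (simp add: z_def power2_norm_eq_inner)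
    have 2: "norm z = (1 / L) * norm (gradient F wstar)"
      using L_pos by (simp add: z_def)
    show ?thesis
      unfolding 1 2 using L_pos by (simp add: power2_eq_square field_simps)
  qed
  finally have "(1 / (2 * L)) * (norm (gradient F wstar))\<^sup>2 \<le> 0" by simp
  then show ?thesis using L_pos by (simp add: mult_le_0_iff divide_le_0_iff)
qed

text \<open>The gradient is split at \<open>wstar\<close>. Convexity and smoothness bound the
  squared difference by a Bregman distance, whose linear term averages to
  \<open>gradient F wstar\<close>, which is 0. The squares at \<open>wstar\<close>, doubled by the
  splitting, average to \<open>N\<close>.\<close>

lemma g_second_moment: "(\<integral>x. (norm (g v x))\<^sup>2 \<partial>P) \<le> 4 * L * (F v - F wstar) + N"
proof -
  have "(norm (g v x))\<^sup>2 \<le>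
      4 * L * (f v x - f wstar x - g wstar x \<bullet> (v - wstar)) + 2 * (norm (g wstar x))\<^sup>2"
    if "x \<in> space P" for x
  proof -
    have "(norm (g v x))\<^sup>2 = (norm ((g v x - g wstar x) + g wstar x))\<^sup>2" by simp
    also have "\<dots> \<le> 2 * (norm (g v x - g wstar x))\<^sup>2 + 2 * (norm (g wstar x))\<^sup>2"
      by (rule norm_add_power2_le)
    also have "(norm (g v x - g wstar x))\<^sup>2 \<le> 2 * L * (f v x - f wstar x - g wstar x \<bullet> (v - wstar))"
      using convex_smooth_gradient_diff[OF f_diff f_smooth f_convex L_pos, OF that that that]
      by (simp add: g_def)
    finally show ?thesis by simp
  qed
  then have "(\<integral>x. (norm (g v x))\<^sup>2 \<partial>P) \<le>
      (\<integral>x. 4 * L * (f v x - f wstar x - g wstar x \<bullet> (v - wstar)) + 2 * (norm (g wstar x))\<^sup>2 \<partial>P)"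
    using f_int g_int N_fin g_norm2_int by (intro integral_mono) auto
  also have "\<dots> = 4 * L * (F v - F wstar - gradient F wstar \<bullet> (v - wstar)) + N"
    using f_int g_int N_fin by (simp add: F_def g_unbiased[symmetric] N_def)
  finally show ?thesis by (simp add: gradient_F_wstar)
qed

lemma N_nonneg: "0 \<le> N"
  unfolding N_def by simp

text \<open>Here \<open>v\<close> is the current iterate, \<open>v'\<close> the value read and
  \<open>c\<close> the step size. The second moment at \<open>v'\<close> is compared with that at
  \<open>v\<close>; since \<open>4 * L * real D * c \<le> 1\<close>, its part proportional to
  \<open>F v - F wstar\<close> is at most \<open>2 * c * (F v - F wstar)\<close>, and the inner
  product with \<open>gradient F v'\<close> cancels exactly this amount.\<close>

lemma expected_step:
  assumes c: "0 \<le> c" "c \<le> 1 / (4 * L * real D)"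
  shows "(norm (v - wstar))\<^sup>2 + c\<^sup>2 * real D * (\<integral>x. (norm (g v' x))\<^sup>2 \<partial>P)
      - 2 * c * ((v - wstar) \<bullet> gradient F v')
    \<le> (1 - \<mu> * c / 2) * (norm (v - wstar))\<^sup>2
      + ((L + \<mu>) * c + 2 * L\<^sup>2 * c\<^sup>2 * real D) * (norm (v' - v))\<^sup>2 + 2 * c\<^sup>2 * real D * N"
proof -
  define Q where "Q = (\<integral>x. (norm (g v' x))\<^sup>2 \<partial>P)"
  have "Q \<le> (\<integral>x. 2 * L\<^sup>2 * (norm (v' - v))\<^sup>2 + 2 * (norm (g v x))\<^sup>2 \<partial>P)"
    unfolding Q_def using g_norm2_int g_norm2_le by (intro integral_mono) auto
  also have "\<dots> = 2 * L\<^sup>2 * (norm (v' - v))\<^sup>2 + 2 * (\<integral>x. (norm (g v x))\<^sup>2 \<partial>P)"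
    using g_norm2_int by (simp add: P.prob_space)
  finally have Q: "Q \<le> 2 * L\<^sup>2 * (norm (v' - v))\<^sup>2 + 8 * L * (F v - F wstar) + 2 * N"
    using g_second_moment[of v] by (simp add: algebra_simps)
  have "c\<^sup>2 * real D * Q \<le> c\<^sup>2 * real D * (2 * L\<^sup>2 * (norm (v' - v))\<^sup>2 + 8 * L * (F v - F wstar) + 2 * N)"
    by (intro mult_left_mono Q) auto
  also have "\<dots> = 2 * L\<^sup>2 * c\<^sup>2 * real D * (norm (v' - v))\<^sup>2
      + 2 * c * (4 * L * real D * c) * (F v - F wstar) + 2 * c\<^sup>2 * real D * N"
    by (simp add: power2_eq_square algebra_simps)
  finally have 1: "c\<^sup>2 * real D * Q \<le> 2 * L\<^sup>2 * c\<^sup>2 * real D * (norm (v' - v))\<^sup>2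
      + 2 * c * (4 * L * real D * c) * (F v - F wstar) + 2 * c\<^sup>2 * real D * N" .
  have "4 * L * real D * c \<le> 1"
    using c L_pos D_ge1 by (simp add: field_simps)
  then have "2 * c * (4 * L * real D * c) * (F v - F wstar) \<le> 2 * c * 1 * (F v - F wstar)"
    using c minimizer[of v] by (intro mult_right_mono mult_left_mono) auto
  with 1 have 2: "c\<^sup>2 * real D * Q \<le> 2 * L\<^sup>2 * c\<^sup>2 * real D * (norm (v' - v))\<^sup>2
      + 2 * c * (F v - F wstar) + 2 * c\<^sup>2 * real D * N" by linarith
  have sc: "F v' - F wstar \<le> gradient F v' \<bullet> (v' - wstar) - \<mu> / 2 * (norm (v' - wstar))\<^sup>2"
  proof -
    have "F wstar - F v' \<ge> gradient F v' \<bullet> (wstar - v') + \<mu> / 2 * (norm (wstar - v'))\<^sup>2"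
      using F_sc unfolding strongly_convex_def by blast
    then show ?thesis by (simp add: inner_diff_right norm_minus_commute)
  qed
  have ds: "F v - F v' \<le> gradient F v' \<bullet> (v - v') + L / 2 * (norm (v' - v))\<^sup>2"
    using F_descent[of v v'] by (simp add: norm_minus_commute)
  \<comment> \<open>The displacement is split at \<open>v'\<close>: strong convexity handles the
    part from \<open>wstar\<close> to \<open>v'\<close>, the descent inequality for \<open>F\<close>
    the part from \<open>v'\<close> to \<open>v\<close>.\<close>
  have "gradient F v' \<bullet> (v - wstar) = gradient F v' \<bullet> (v' - wstar) + gradient F v' \<bullet> (v - v')"
    by (simp add: inner_diff_right)
  with sc ds have 3: "F v - F wstar + \<mu> / 2 * (norm (v' - wstar))\<^sup>2 - L / 2 * (norm (v' - v))\<^sup>2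
      \<le> (v - wstar) \<bullet> gradient F v'" by (simp add: inner_commute)
  \<comment> \<open>Strong convexity gives a contraction in terms of \<open>v'\<close>, but the
    recurrence is in terms of \<open>v\<close>. The exchange halves the contraction constant and
    adds \<open>\<mu> / 2\<close> times the squared lag.\<close>
  have "(norm (v - wstar))\<^sup>2 \<le> 2 * (norm (v' - wstar))\<^sup>2 + 2 * (norm (v' - v))\<^sup>2"
    using norm_add_power2_le[of "v' - wstar" "v - v'"] by (simp add: norm_minus_commute)
  then have "\<mu> / 4 * (norm (v - wstar))\<^sup>2 \<le> \<mu> / 4 * (2 * (norm (v' - wstar))\<^sup>2 + 2 * (norm (v' - v))\<^sup>2)"
    using mu_pos by (intro mult_left_mono) auto
  also have "\<dots> = \<mu> / 2 * (norm (v' - wstar))\<^sup>2 + \<mu> / 2 * (norm (v' - v))\<^sup>2"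
    by (simp add: algebra_simps)
  finally have "F v - F wstar + \<mu> / 4 * (norm (v - wstar))\<^sup>2 - (L + \<mu>) / 2 * (norm (v' - v))\<^sup>2
      \<le> (v - wstar) \<bullet> gradient F v'" using 3 by (simp add: algebra_simps add_divide_distrib)
  then have "2 * c * (F v - F wstar + \<mu> / 4 * (norm (v - wstar))\<^sup>2 - (L + \<mu>) / 2 * (norm (v' - v))\<^sup>2)
      \<le> 2 * c * ((v - wstar) \<bullet> gradient F v')"
    using c by (intro mult_left_mono) auto
  then have 4: "2 * c * (F v - F wstar) + \<mu> * c / 2 * (norm (v - wstar))\<^sup>2
       - (L + \<mu>) * c * (norm (v' - v))\<^sup>2 \<le> 2 * c * ((v - wstar) \<bullet> gradient F v')"
    by (simp add: field_simps)
  show ?thesis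
    using 2 4 unfolding Q_def[symmetric] by (simp add: algebra_simps)
qed

section \<open>Measurability of the gradient and of the number of filters\<close>

lemma g_joint_meas [measurable]: "(\<lambda>p. g (fst p) (snd p)) \<in> borel_measurable (borel \<Otimes>\<^sub>M P)"
proof (rule borel_measurable_Caratheodory)
  fix x v assume "x \<in> space P"
  then have "L-lipschitz_on UNIV (\<lambda>v. g v x)"
    using g_lipschitz L_pos by (auto simp: lipschitz_on_def dist_norm)
  then have "continuous_on UNIV (\<lambda>v. g v x)"
    by (rule lipschitz_on_continuous_on)
  then show "isCont (\<lambda>v. g v x) v"
    by (simp add: continuous_on_eq_continuous_at)
qed measurable

text \<open>The support is defined by an existential over uncountably many points. By continuity of
  the gradient, the set where an entry is non-zero is open, so a countable dense set of points
  suffices. The support takes finitely many values, so its measurability is checked on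
  singletons.\<close>

lemma d_meas [measurable]: "d\<xi> \<in> measurable P (count_space UNIV)"
proof -
  obtain Q :: "(real ^ 'd) set" where Q: "countable Q"
    and dense: "\<And>X. open X \<Longrightarrow> X \<noteq> {} \<Longrightarrow> \<exists>q\<in>Q. q \<in> X"
    by (rule countable_dense_setE) blast
  have supp: "i \<in> grad_support (\<lambda>v. f v x) \<longleftrightarrow> (\<exists>q\<in>Q. g q x $ i \<noteq> 0)" if "x \<in> space P" for x i
  proof
    assume "i \<in> grad_support (\<lambda>v. f v x)"
    then obtain v where "g v x $ i \<noteq> 0" by (auto simp: grad_support_def g_def)
    then have "{v. g v x $ i \<noteq> 0} \<noteq> {}" by auto
    moreover have "open {v. g v x $ i \<noteq> 0}"
    proof -
      have "L-lipschitz_on UNIV (\<lambda>v. g v x)"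
        using g_lipschitz that L_pos by (auto simp: lipschitz_on_def dist_norm)
      then have "continuous_on UNIV (\<lambda>v. g v x $ i)"
        by (intro continuous_intros lipschitz_on_continuous_on)
      then show ?thesis
        by (intro open_Collect_neq) auto
    qed
    ultimately show "\<exists>q\<in>Q. g q x $ i \<noteq> 0" using dense by blast
  qed (auto simp: grad_support_def g_def)
  have "(\<lambda>x. grad_support (\<lambda>v. f v x)) \<in> measurable P (count_space UNIV)"
  proof (subst measurable_count_space_eq_countable)
    have "(\<lambda>x. grad_support (\<lambda>v. f v x)) -` {A} \<inter> space P
        = {x \<in> space P. \<forall>i\<in>UNIV. (\<exists>q\<in>Q. g q x $ i \<noteq> 0) \<longleftrightarrow> i \<in> A}" for A
      using supp by (auto simp: set_eq_iff)
    moreover have "{x \<in> space P. \<forall>i\<in>UNIV. (\<exists>q\<in>Q. g q x $ i \<noteq> 0) \<longleftrightarrow> i \<in> A} \<in> sets P" for A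
    proof -
      have [measurable]: "Measurable.pred P (\<lambda>x. \<exists>q\<in>Q. g q x $ i \<noteq> 0)" for i
        unfolding pred_def using Q by (intro sets.sets_Collect_countable_Ex') measurable
      show ?thesis by measurable
    qed
    ultimately show "(\<lambda>x. grad_support (\<lambda>v. f v x)) \<in> space P \<rightarrow> UNIV \<and>
        (\<forall>A\<in>UNIV. (\<lambda>x. grad_support (\<lambda>v. f v x)) -` {A} \<inter> space P \<in> sets P)"
      by simp
  qed simp
  then show ?thesis
    unfolding d\<xi>_def by (rule measurable_compose) simp
qed

section \<open>Filtered gradients and their averages over the blocks\<close>

definition step :: "real ^ 'd \<Rightarrow> 'x \<Rightarrow> nat \<Rightarrow> real ^ 'd" where
  "step v x k = real (d\<xi> x) *\<^sub>R (diag01 (S x k) *v g v x)"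

lemma step_measurable:
  assumes V: "V \<in> borel_measurable R" and X: "X \<in> measurable R P"
    and K: "K \<in> measurable R (count_space UNIV)"
  shows "(\<lambda>\<omega>. step (V \<omega>) (X \<omega>) (K \<omega>)) \<in> borel_measurable R"
proof -
  have "(\<lambda>\<omega>. step (V \<omega>) (X \<omega>) k) \<in> borel_measurable R" for k
  proof -
    have [measurable]: "(\<lambda>\<omega>. g (V \<omega>) (X \<omega>)) \<in> borel_measurable R"
      using measurable_compose[OF measurable_Pair[OF V X] g_joint_meas] by simp
    have [measurable]: "(\<lambda>\<omega>. S (X \<omega>) k) \<in> measurable R (count_space UNIV)"
      using measurable_compose[OF X S_meas] .
    have [measurable]: "(\<lambda>\<omega>. real (d\<xi> (X \<omega>))) \<in> borel_measurable R"
      using measurable_compose[OF measurable_compose[OF X d_meas], of real borel] by simp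
    show ?thesis unfolding step_def by measurable
  qed
  then show ?thesis
    using K by (rule measurable_compose_countable)
qed

text \<open>If \<open>d\<xi> x = 0\<close>, then \<open>g v x = 0\<close>, and the averages are empty sums divided by \<open>0\<close>, hence \<open>0\<close>.\<close>

lemma step_average:
  assumes x: "x \<in> space P"
  shows "(\<Sum>k<d\<xi> x. step v x k) /\<^sub>R real (d\<xi> x) = g v x"
    and "(\<Sum>k<d\<xi> x. (norm (step v x k))\<^sup>2) / real (d\<xi> x) = real (d\<xi> x) * (norm (g v x))\<^sup>2"
proof -
  have 1: "(\<Sum>k<d\<xi> x. diag01 (S x k) *v g v x) = g v x"
    unfolding d\<xi>_def g_def by (rule filter_partition_sum_diag01[OF S_part[OF x]])
  have 2: "(\<Sum>k<d\<xi> x. (norm (diag01 (S x k) *v g v x))\<^sup>2) = (norm (g v x))\<^sup>2"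
    unfolding d\<xi>_def g_def by (rule filter_partition_sum_norm_diag01[OF S_part[OF x]])
  show "(\<Sum>k<d\<xi> x. step v x k) /\<^sub>R real (d\<xi> x) = g v x"
    using 1 by (cases "d\<xi> x = 0") (auto simp: step_def scaleR_sum_right[symmetric])
  show "(\<Sum>k<d\<xi> x. (norm (step v x k))\<^sup>2) / real (d\<xi> x) = real (d\<xi> x) * (norm (g v x))\<^sup>2"
  proof -
    have "(\<Sum>k<d\<xi> x. (norm (step v x k))\<^sup>2) = (real (d\<xi> x))\<^sup>2 * (norm (g v x))\<^sup>2"
      by (simp add: step_def power_mult_distrib sum_distrib_left[symmetric] 2)
    then show ?thesis by (simp add: power2_eq_square)
  qed
qed

text \<open>A crude pointwise bound that serves for integrability; the sharp factor in second
  moments comes from \<open>step_average\<close>.\<close>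

lemma step_norm_le: "norm (step v x k) \<le> real D * norm (g v x)"
  unfolding step_def using d_le_D[of x] norm_diag01_mult_vec_le[of "S x k" "g v x"]
  by (auto intro!: mult_mono)


section \<open>The history and measurability of the iterates\<close>

lemma space_hist [simp]: "space (hist t) = space M"
  unfolding history_def by (rule space_measure_of) auto

lemma sets_hist: "sets (hist t) = sigma_sets (space M)
     ({w 0 -` A \<inter> space M | A. A \<in> sets borel} \<union>
      {\<xi> s -` A \<inter> space M | s A. s < t \<and> A \<in> sets P} \<union>
      {u s -` A \<inter> space M | s A. s < t} \<union>
      {\<Sigma> s j -` A \<inter> space M | s j A. s \<le> t \<and> j \<in> {s - \<tau> s..<s}})"
  unfolding history_def by (rule sets_measure_of) auto

lemma w_0_meas: "w 0 \<in> borel_measurable R" if "space R = space M" for R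
proof -
  have "w 0 \<in> borel_measurable R \<longleftrightarrow> (\<lambda>_. w0) \<in> borel_measurable R"
    using w_0 that by (intro measurable_cong) simp
  then show ?thesis by simp
qed

lemma subalgebra_hist: "subalgebra M (hist t)"
proof (unfold subalgebra_def, intro conjI)
  show "sets (hist t) \<subseteq> sets M"
    unfolding sets_hist
    using measurable_sets[OF w_0_meas[OF refl]] measurable_sets[OF xi_meas]
      measurable_sets[OF u_meas] measurable_sets[OF mask_meas]
    by (intro sets.sigma_sets_subset) auto
qed simp

lemma hist_meas_xi: "\<xi> s \<in> measurable (hist t) P" if "s < t"
proof (rule measurableI)
  fix A assume "A \<in> sets P"
  with that show "\<xi> s -` A \<inter> space (hist t) \<in> sets (hist t)"
    unfolding sets_hist by (intro sigma_sets.Basic) auto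
qed (use measurable_space[OF xi_meas] in simp)

lemma hist_meas_u: "u s \<in> measurable (hist t) (count_space UNIV)" if "s < t"
proof (rule measurableI)
  fix A :: "nat set"
  from that show "u s -` A \<inter> space (hist t) \<in> sets (hist t)"
    unfolding sets_hist by (intro sigma_sets.Basic) auto
qed simp

lemma hist_meas_mask: "\<Sigma> s j \<in> measurable (hist t) (count_space UNIV)"
  if "s \<le> t" "j \<in> {s - \<tau> s..<s}"
proof (rule measurableI)
  fix A :: "'d set set"
  from that show "\<Sigma> s j -` A \<inter> space (hist t) \<in> sets (hist t)"
    unfolding sets_hist space_hist by (intro sigma_sets.Basic UnI2) blast
qed simp

abbreviation move :: "nat \<Rightarrow> 'a \<Rightarrow> real ^ 'd" where
  "move j \<equiv> (\<lambda>\<omega>. step (what j \<omega>) (\<xi> j \<omega>) (u j \<omega>))"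

lemma w_step: "w (Suc t) \<omega> = w t \<omega> - \<eta> t *\<^sub>R move t \<omega>" if "\<omega> \<in> space M"
  using w_Suc[OF that, of t] by (simp add: step_def)

lemma what_move: "what t \<omega> = w (t - \<tau> t) \<omega> -
    (\<Sum>j\<in>{t - \<tau> t..<t}. \<eta> j *\<^sub>R (diag01 (\<Sigma> t j \<omega>) *v move j \<omega>))" if "\<omega> \<in> space M"
  using consistent[OF that, of t] by (simp add: step_def matrix_vector_mult_scaleR)

lemma w_telescope: "s \<le> t \<Longrightarrow> w t \<omega> = w s \<omega> - (\<Sum>j\<in>{s..<t}. \<eta> j *\<^sub>R move j \<omega>)"
  if "\<omega> \<in> space M"
proof (induction t rule: dec_induct)
  case (step t)
  then show ?case by (simp add: w_step[OF that])
qed simp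

text \<open>Read and iterate share the starting point \<open>w (t - \<tau> t)\<close>, so they
  differ exactly by the entries of the intermediate updates that the masks leave out.\<close>

lemma what_minus_w: "what t \<omega> - w t \<omega> =
    (\<Sum>j\<in>{t - \<tau> t..<t}. \<eta> j *\<^sub>R (move j \<omega> - diag01 (\<Sigma> t j \<omega>) *v move j \<omega>))"
  if "\<omega> \<in> space M"
  using w_telescope[OF that, of "t - \<tau> t" t] what_move[OF that, of t]
  by (simp add: scaleR_diff_right sum_subtractf)

text \<open>Both \<open>w s\<close> and \<open>what s\<close> are built from updates with index
  below \<open>s\<close>, whose samples and block indices belong to the history at any
  \<open>t \<ge> s\<close>. The read also uses the masks of time \<open>s\<close> itself, which the
  history includes. Hence \<open>w t\<close> and \<open>what t\<close> are settled before the sample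
  and the index of time \<open>t\<close> are drawn.\<close>

lemma hist_meas_w_what:
  "s \<le> t \<Longrightarrow> w s \<in> borel_measurable (hist t) \<and> what s \<in> borel_measurable (hist t)"
proof (induction s rule: less_induct)
  case (less s)
  have mv: "move j \<in> borel_measurable (hist t)" if "j < s" for j
    using less that hist_meas_xi[of j t] hist_meas_u[of j t] by (intro step_measurable) auto
  have w: "w s \<in> borel_measurable (hist t)"
  proof (cases s)
    case 0
    then show ?thesis using w_0_meas by simp
  next
    case (Suc r)
    have "w r \<in> borel_measurable (hist t)" using less Suc by auto
    then have "(\<lambda>\<omega>. w r \<omega> - \<eta> r *\<^sub>R move r \<omega>) \<in> borel_measurable (hist t)"
      using mv[of r] Suc by (intro borel_measurable_diff borel_measurable_scaleR) auto
    then show ?thesis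
      unfolding Suc by (rule measurable_cong[THEN iffD2, rotated]) (simp add: w_step)
  qed
  moreover have "what s \<in> borel_measurable (hist t)"
  proof -
    \<comment> \<open>If \<open>s\<close> or the delay is 0, the read starts from \<open>w s\<close>
      itself, which the induction hypothesis does not cover but \<open>w\<close> does.\<close>
    have "w (s - \<tau> s) \<in> borel_measurable (hist t)"
    proof (cases "s - \<tau> s < s")
      case True
      then show ?thesis using less by auto
    next
      case False
      then have "s - \<tau> s = s" by simp
      then show ?thesis using w by simp
    qed
    moreover have "(\<lambda>\<omega>. \<Sum>j\<in>{s - \<tau> s..<s}. \<eta> j *\<^sub>R (diag01 (\<Sigma> s j \<omega>) *v move j \<omega>))
        \<in> borel_measurable (hist t)"
      using mv hist_meas_mask[OF less(2)]
      by (intro borel_measurable_sum borel_measurable_scaleR borel_measurable_diag01_mult_vec) auto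
    ultimately have "(\<lambda>\<omega>. w (s - \<tau> s) \<omega> -
        (\<Sum>j\<in>{s - \<tau> s..<s}. \<eta> j *\<^sub>R (diag01 (\<Sigma> s j \<omega>) *v move j \<omega>))) \<in> borel_measurable (hist t)"
      by (rule borel_measurable_diff)
    then show ?thesis
      by (rule measurable_cong[THEN iffD2, rotated]) (simp add: what_move)
  qed
  ultimately show ?case ..
qed

lemmas hist_meas_w = hist_meas_w_what[OF order_refl, THEN conjunct1]
lemmas hist_meas_what = hist_meas_w_what[OF order_refl, THEN conjunct2]

lemma w_meas [measurable]: "w t \<in> borel_measurable M"
  by (rule measurable_from_subalg[OF subalgebra_hist hist_meas_w])

lemma what_meas [measurable]: "what t \<in> borel_measurable M"
  by (rule measurable_from_subalg[OF subalgebra_hist hist_meas_what])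

section \<open>Finite second moments\<close>

declare xi_meas [measurable] u_meas [measurable]

lemma move_meas [measurable]: "move t \<in> borel_measurable M"
  by (intro step_measurable) measurable

lemma g_what_meas [measurable]: "(\<lambda>\<omega>. g (what t \<omega>) (\<xi> t \<omega>)) \<in> borel_measurable M"
  using measurable_compose[OF measurable_Pair[OF what_meas xi_meas] g_joint_meas] by simp

lemma xi_space: "\<omega> \<in> space M \<Longrightarrow> \<xi> t \<omega> \<in> space P"
  using measurable_space[OF xi_meas] .

lemma g_wstar_xi:
  shows "integrable M (\<lambda>\<omega>. (norm (g wstar (\<xi> t \<omega>)))\<^sup>2)"
    and "2 * (\<integral>\<omega>. (norm (g wstar (\<xi> t \<omega>)))\<^sup>2 \<partial>M) = N"
proof -
  have m: "(\<lambda>x. (norm (g wstar x))\<^sup>2) \<in> borel_measurable P" by measurable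
  show "integrable M (\<lambda>\<omega>. (norm (g wstar (\<xi> t \<omega>)))\<^sup>2)"
    using integrable_distr_eq[OF xi_meas, of "\<lambda>x. (norm (g wstar x))\<^sup>2" t] m N_fin
    by (simp add: xi_distr)
  show "2 * (\<integral>\<omega>. (norm (g wstar (\<xi> t \<omega>)))\<^sup>2 \<partial>M) = N"
    using integral_distr[OF xi_meas m, of t] by (simp add: xi_distr N_def)
qed

lemma sq_g_what:
  assumes "square_integrable M (\<lambda>\<omega>. what t \<omega> - wstar)"
  shows "square_integrable M (\<lambda>\<omega>. g (what t \<omega>) (\<xi> t \<omega>))"
  unfolding square_integrable_def
proof
  show "integrable M (\<lambda>\<omega>. (norm (g (what t \<omega>) (\<xi> t \<omega>)))\<^sup>2)"
  proof (rule Bochner_Integration.integrable_bound)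
    show "integrable M (\<lambda>\<omega>. 2 * L\<^sup>2 * (norm (what t \<omega> - wstar))\<^sup>2 + 2 * (norm (g wstar (\<xi> t \<omega>)))\<^sup>2)"
      using assms g_wstar_xi by (simp add: square_integrable_def)
    show "AE \<omega> in M. norm ((norm (g (what t \<omega>) (\<xi> t \<omega>)))\<^sup>2)
        \<le> norm (2 * L\<^sup>2 * (norm (what t \<omega> - wstar))\<^sup>2 + 2 * (norm (g wstar (\<xi> t \<omega>)))\<^sup>2)"
      using g_norm2_le xi_space by (intro AE_I2) simp
  qed measurable
qed measurable

text \<open>Strong induction: \<open>w t\<close> is the constant start plus finitely many earlier
  updates, and the lag is a finite sum of masked earlier updates. Each update is dominated by the
  gradient at its read, which is square integrable as soon as that read is.\<close>

lemma sq_w_what: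
  "square_integrable M (\<lambda>\<omega>. w t \<omega> - wstar) \<and> square_integrable M (\<lambda>\<omega>. what t \<omega> - wstar)"
proof (induction t rule: less_induct)
  case (less t)
  have mv: "square_integrable M (move j)" if "j < t" for j
    by (rule square_integrable_bound[OF sq_g_what[OF less[OF that, THEN conjunct2]] move_meas step_norm_le])
  have const: "square_integrable M (\<lambda>\<omega>. w 0 \<omega> - wstar)"
  proof -
    have "integrable M (\<lambda>\<omega>. (norm (w 0 \<omega> - wstar))\<^sup>2) \<longleftrightarrow> integrable M (\<lambda>\<omega>. (norm (w0 - wstar))\<^sup>2)"
      using w_0 by (intro Bochner_Integration.integrable_cong) auto
    then show ?thesis by (simp add: square_integrable_def)
  qed
  have eq: "w t \<omega> - wstar = (w 0 \<omega> - wstar) - (\<Sum>j\<in>{0..<t}. \<eta> j *\<^sub>R move j \<omega>)"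
    if "\<omega> \<in> space M" for \<omega>
    using w_telescope[OF that, of 0 t] by simp
  have w: "square_integrable M (\<lambda>\<omega>. w t \<omega> - wstar)"
  proof (rule square_integrable_bound[where c = 1])
    show "square_integrable M (\<lambda>\<omega>. (w 0 \<omega> - wstar) - (\<Sum>j\<in>{0..<t}. \<eta> j *\<^sub>R move j \<omega>))"
      using mv by (intro square_integrable_diff const square_integrable_sum square_integrable_scaleR) auto
    show "norm (w t \<omega> - wstar) \<le> 1 * norm ((w 0 \<omega> - wstar) - (\<Sum>j\<in>{0..<t}. \<eta> j *\<^sub>R move j \<omega>))"
      if "\<omega> \<in> space M" for \<omega>
      unfolding eq[OF that] by simp
  qed (intro borel_measurable_diff w_meas borel_measurable_const)
  moreover have "square_integrable M (\<lambda>\<omega>. what t \<omega> - w t \<omega>)"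
  proof (rule square_integrable_bound[where c = 1])
    show "square_integrable M (\<lambda>\<omega>. \<Sum>j\<in>{t - \<tau> t..<t}. \<eta> j *\<^sub>R (move j \<omega> - diag01 (\<Sigma> t j \<omega>) *v move j \<omega>))"
    proof (intro square_integrable_sum square_integrable_scaleR)
      fix j assume j: "j \<in> {t - \<tau> t..<t}"
      show "square_integrable M (\<lambda>\<omega>. move j \<omega> - diag01 (\<Sigma> t j \<omega>) *v move j \<omega>)"
      proof (rule square_integrable_bound[where c = 1 and X = "move j"])
        show "square_integrable M (move j)" using mv j by simp
        show "(\<lambda>\<omega>. move j \<omega> - diag01 (\<Sigma> t j \<omega>) *v move j \<omega>) \<in> borel_measurable M"
          using mask_meas[OF j]
          by (intro borel_measurable_diff borel_measurable_diag01_mult_vec move_meas)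
      qed (simp add: norm_diff_diag01_mult_vec_le)
    qed
    show "norm (what t \<omega> - w t \<omega>) \<le> 1 * norm
        (\<Sum>j\<in>{t - \<tau> t..<t}. \<eta> j *\<^sub>R (move j \<omega> - diag01 (\<Sigma> t j \<omega>) *v move j \<omega>))"
      if "\<omega> \<in> space M" for \<omega>
      using what_minus_w[OF that, of t] by simp
  qed (intro borel_measurable_diff w_meas what_meas)
  ultimately have "square_integrable M (\<lambda>\<omega>. (what t \<omega> - w t \<omega>) + (w t \<omega> - wstar))"
    by (intro square_integrable_add) auto
  with w show ?case by simp
qed

lemmas sq_w = sq_w_what[THEN conjunct1]
lemmas sq_what = sq_w_what[THEN conjunct2]
lemmas sq_g = sq_g_what[OF sq_what]

lemma sq_step:
  assumes "K \<in> measurable M (count_space UNIV)"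
  shows "square_integrable M (\<lambda>\<omega>. step (what t \<omega>) (\<xi> t \<omega>) (K \<omega>))"
  by (rule square_integrable_bound[OF sq_g step_measurable[OF what_meas xi_meas assms] step_norm_le])

lemma sq_diff: "square_integrable M (\<lambda>\<omega>. what t \<omega> - w t \<omega>)"
  using square_integrable_diff[OF sq_what sq_w] by simp

section \<open>Averaging over the random index and over the fresh sample\<close>

abbreviation "hist' t \<equiv> adjoin (hist t) (\<xi> t) P"

lemma space_hist' [simp]: "space (hist' t) = space M"
  unfolding adjoin_def using sets.sets_into_space[of _ "hist t"] by (subst space_measure_of) auto

lemma sets_hist': "sets (hist' t) =
    sigma_sets (space M) (sets (hist t) \<union> {\<xi> t -` A \<inter> space M | A. A \<in> sets P})"
  unfolding adjoin_def using sets.sets_into_space[of _ "hist t"] by (subst sets_measure_of) auto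

lemma subalgebra_hist': "subalgebra M (hist' t)"
proof (unfold subalgebra_def, intro conjI)
  show "sets (hist' t) \<subseteq> sets M"
    unfolding sets_hist' using subalgebra_hist[of t] measurable_sets[OF xi_meas]
    by (intro sets.sigma_sets_subset) (auto simp: subalgebra_def)
qed simp

lemma hist_imp_hist': "X \<in> measurable (hist t) R \<Longrightarrow> X \<in> measurable (hist' t) R"
  by (rule measurable_from_subalg[rotated]) (auto simp: subalgebra_def sets_hist')

lemma hist'_meas_xi: "\<xi> t \<in> measurable (hist' t) P"
proof (rule measurableI)
  fix A assume "A \<in> sets P"
  then show "\<xi> t -` A \<inter> space (hist' t) \<in> sets (hist' t)"
    unfolding sets_hist' by (intro sigma_sets.Basic) auto
qed (use xi_space in simp)

text \<open>The factor \<open>Y\<close> is known given the history and the sample, so the indicator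
  of \<open>u t = k\<close> may be replaced by its conditional expectation. The guard
  \<open>k < d\<xi> (\<xi> t \<omega>)\<close> confines this to the event on which that expectation
  is prescribed.\<close>

lemma uniform_index_aux:
  assumes Xm: "X \<in> borel_measurable (hist' t)" and Xi: "integrable M X"
  shows "(\<integral>\<omega>. (if k < d\<xi> (\<xi> t \<omega>) \<and> u t \<omega> = k then X \<omega> else 0) \<partial>M)
    = (\<integral>\<omega>. (if k < d\<xi> (\<xi> t \<omega>) then X \<omega> / real (d\<xi> (\<xi> t \<omega>)) else 0) \<partial>M)"
proof -
  interpret finite_measure_subalgebra M "hist' t"
    by unfold_locales (rule subalgebra_hist')
  have [measurable]: "X \<in> borel_measurable M"
    by (rule measurable_from_subalg[OF subalgebra_hist' Xm])
  define ind :: "'a \<Rightarrow> real" where "ind = indicator {\<omega> \<in> space M. u t \<omega> = k}"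
  define Y where "Y = (\<lambda>\<omega>. if k < d\<xi> (\<xi> t \<omega>) then X \<omega> else 0)"
  have [measurable]: "ind \<in> borel_measurable M" unfolding ind_def by measurable
  have Ym: "Y \<in> borel_measurable (hist' t)"
    unfolding Y_def using Xm hist'_meas_xi[of t] by measurable
  have [measurable]: "Y \<in> borel_measurable M" unfolding Y_def by measurable
  have "integrable M (\<lambda>\<omega>. Y \<omega> * ind \<omega>)"
    by (rule Bochner_Integration.integrable_bound[OF Xi]) (auto simp: Y_def ind_def indicator_def)
  from real_cond_exp_intg(2)[OF this Ym]
  have "(\<integral>\<omega>. Y \<omega> * real_cond_exp M (hist' t) ind \<omega> \<partial>M) = (\<integral>\<omega>. Y \<omega> * ind \<omega> \<partial>M)"
    by simp
  also have "(\<integral>\<omega>. Y \<omega> * ind \<omega> \<partial>M)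
      = (\<integral>\<omega>. (if k < d\<xi> (\<xi> t \<omega>) \<and> u t \<omega> = k then X \<omega> else 0) \<partial>M)"
    by (intro Bochner_Integration.integral_cong) (auto simp: Y_def ind_def indicator_def)
  also have "(\<integral>\<omega>. Y \<omega> * real_cond_exp M (hist' t) ind \<omega> \<partial>M)
      = (\<integral>\<omega>. (if k < d\<xi> (\<xi> t \<omega>) then X \<omega> / real (d\<xi> (\<xi> t \<omega>)) else 0) \<partial>M)"
    using u_unif[of k t] by (intro integral_cong_AE) (auto simp: Y_def ind_def)
  finally show ?thesis by simp
qed

text \<open>The prescribed conditional probabilities of the valid indices add up to 1, so no mass is
  left for the others. Formally, the indicator of a valid index is dominated by that of
  \<open>0 < d\<xi>\<close> and has the same integral, so the two agree almost everywhere.\<close>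

lemma AE_index_less: "AE \<omega> in M. 0 < d\<xi> (\<xi> t \<omega>) \<longrightarrow> u t \<omega> < d\<xi> (\<xi> t \<omega>)"
proof -
  let ?d = "\<lambda>\<omega>. d\<xi> (\<xi> t \<omega>)"
  have [measurable]: "Measurable.pred M (\<lambda>\<omega>. u t \<omega> < ?d \<omega>)"
    by (rule measurable_compose_countable[OF _ u_meas]) measurable
  have i1: "integrable M (\<lambda>\<omega>. if k < ?d \<omega> \<and> u t \<omega> = k then 1 else 0 :: real)" for k
    by (intro M.integrable_const_bound[where B = 1]) auto
  have i2: "integrable M (\<lambda>\<omega>. if k < ?d \<omega> then 1 / real (?d \<omega>) else 0 :: real)" for k
    by (intro M.integrable_const_bound[where B = 1]) (auto simp: divide_le_eq)
  \<comment> \<open>The random index range is replaced by the fixed range below \<open>D\<close>, so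
    that sum and integral can be exchanged.\<close>
  have s1: "(\<Sum>k<D. if k < ?d \<omega> \<and> u t \<omega> = k then 1 else 0 :: real) = (if u t \<omega> < ?d \<omega> then 1 else 0)" for \<omega>
  proof -
    have "(\<Sum>k<D. if k < ?d \<omega> \<and> u t \<omega> = k then 1 else 0 :: real)
        = (\<Sum>k<D. if u t \<omega> = k then (if u t \<omega> < ?d \<omega> then 1 else 0) else 0)"
      by (intro sum.cong) auto
    then show ?thesis using d_le_D[of "\<xi> t \<omega>"] by auto
  qed
  have s2: "(\<Sum>k<D. if k < ?d \<omega> then 1 / real (?d \<omega>) else 0 :: real) = (if 0 < ?d \<omega> then 1 else 0)" for \<omega>
  proof -
    have "(\<Sum>k<D. if k < ?d \<omega> then 1 / real (?d \<omega>) else 0 :: real) = (\<Sum>k<?d \<omega>. 1 / real (?d \<omega>))"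
      using d_le_D[of "\<xi> t \<omega>"] by (intro sum.mono_neutral_cong_right) auto
    then show ?thesis by simp
  qed
  have "(\<integral>\<omega>. (if u t \<omega> < ?d \<omega> then 1 else 0 :: real) \<partial>M) = (\<integral>\<omega>. (if 0 < ?d \<omega> then 1 else 0) \<partial>M)"
    unfolding s1[symmetric] s2[symmetric]
    by (simp add: Bochner_Integration.integral_sum i1 i2 uniform_index_aux)
  moreover have i3: "integrable M (\<lambda>\<omega>. if u t \<omega> < ?d \<omega> then 1 else 0 :: real)"
    by (intro M.integrable_const_bound[where B = 1]) auto
  moreover have i4: "integrable M (\<lambda>\<omega>. if 0 < ?d \<omega> then 1 else 0 :: real)"
    by (intro M.integrable_const_bound[where B = 1]) auto
  ultimately have "(\<integral>\<omega>. (if 0 < ?d \<omega> then 1 else 0) - (if u t \<omega> < ?d \<omega> then 1 else 0 :: real) \<partial>M) = 0"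
    by simp
  then have "AE \<omega> in M. (if 0 < ?d \<omega> then 1 else 0) - (if u t \<omega> < ?d \<omega> then 1 else 0 :: real) = 0"
    using i3 i4 by (subst (asm) integral_nonneg_eq_0_iff_AE) (auto intro!: Bochner_Integration.integrable_diff)
  then show ?thesis by eventually_elim (auto split: if_splits)
qed

text \<open>Nothing is known about \<open>u t\<close> where \<open>d\<xi> = 0\<close>, so \<open>X\<close> has to vanish there.\<close>

lemma uniform_index:
  assumes Xm: "\<And>k. X k \<in> borel_measurable (hist' t)" and Xi: "\<And>k. integrable M (X k)"
    and X0: "\<And>k \<omega>. \<omega> \<in> space M \<Longrightarrow> d\<xi> (\<xi> t \<omega>) = 0 \<Longrightarrow> X k \<omega> = 0"
  shows "(\<integral>\<omega>. X (u t \<omega>) \<omega> \<partial>M) = (\<integral>\<omega>. (\<Sum>k<d\<xi> (\<xi> t \<omega>). X k \<omega>) / real (d\<xi> (\<xi> t \<omega>)) \<partial>M)"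
proof -
  let ?d = "\<lambda>\<omega>. d\<xi> (\<xi> t \<omega>)"
  have [measurable]: "X k \<in> borel_measurable M" for k
    by (rule measurable_from_subalg[OF subalgebra_hist' Xm])
  have i1: "integrable M (\<lambda>\<omega>. if k < ?d \<omega> \<and> u t \<omega> = k then X k \<omega> else 0)" for k
    by (rule Bochner_Integration.integrable_bound[OF Xi[of k]]) auto
  have i2: "integrable M (\<lambda>\<omega>. if k < ?d \<omega> then X k \<omega> / real (?d \<omega>) else 0)" for k
    by (rule Bochner_Integration.integrable_bound[OF Xi[of k]])
      (auto simp: divide_le_eq mult_le_cancel_left1)
  have "(\<integral>\<omega>. X (u t \<omega>) \<omega> \<partial>M) = (\<integral>\<omega>. (\<Sum>k<D. if k < ?d \<omega> \<and> u t \<omega> = k then X k \<omega> else 0) \<partial>M)"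
  proof (rule integral_cong_AE)
    show "(\<lambda>\<omega>. X (u t \<omega>) \<omega>) \<in> borel_measurable M"
      by (rule measurable_compose_countable[OF _ u_meas]) measurable
    show "AE \<omega> in M. X (u t \<omega>) \<omega> = (\<Sum>k<D. if k < ?d \<omega> \<and> u t \<omega> = k then X k \<omega> else 0)"
      using AE_index_less[of t] AE_space
    proof eventually_elim
      case (elim \<omega>)
      have "(\<Sum>k<D. if k < ?d \<omega> \<and> u t \<omega> = k then X k \<omega> else 0)
          = (\<Sum>k<D. if u t \<omega> = k then (if u t \<omega> < ?d \<omega> then X (u t \<omega>) \<omega> else 0) else 0)"
        by (intro sum.cong) auto
      also have "\<dots> = (if u t \<omega> < ?d \<omega> then X (u t \<omega>) \<omega> else 0)"
        using d_le_D[of "\<xi> t \<omega>"] by auto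
      also have "\<dots> = X (u t \<omega>) \<omega>" using elim X0 by auto
      finally show ?case ..
    qed
  qed measurable
  also have "\<dots> = (\<integral>\<omega>. (\<Sum>k<D. if k < ?d \<omega> then X k \<omega> / real (?d \<omega>) else 0) \<partial>M)"
    by (simp add: Bochner_Integration.integral_sum i1 i2 uniform_index_aux Xm Xi)
  also have "\<dots> = (\<integral>\<omega>. (\<Sum>k<?d \<omega>. X k \<omega>) / real (?d \<omega>) \<partial>M)"
  proof (intro Bochner_Integration.integral_cong refl)
    fix \<omega>
    show "(\<Sum>k<D. if k < ?d \<omega> then X k \<omega> / real (?d \<omega>) else 0) = (\<Sum>k<?d \<omega>. X k \<omega>) / real (?d \<omega>)"
      unfolding sum_divide_distrib using d_le_D[of "\<xi> t \<omega>"]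
      by (intro sum.mono_neutral_cong_right) auto
  qed
  finally show ?thesis .
qed

text \<open>Independence makes the joint law of \<open>X\<close> and \<open>\<xi> t\<close> the
  product of the law of \<open>X\<close> with \<open>P\<close>, which is checked on rectangles;
  Fubini then integrates out the sample with \<open>X\<close> frozen.\<close>

lemma expectation_independent:
  fixes X :: "'a \<Rightarrow> 'c::topological_space" and \<phi> :: "'c \<times> 'x \<Rightarrow> real"
  assumes X: "X \<in> borel_measurable (hist t)" and \<phi>: "\<phi> \<in> borel_measurable (borel \<Otimes>\<^sub>M P)"
    and int: "integrable M (\<lambda>\<omega>. \<phi> (X \<omega>, \<xi> t \<omega>))"
  shows "integrable M (\<lambda>\<omega>. \<integral>x. \<phi> (X \<omega>, x) \<partial>P)"
    and "(\<integral>\<omega>. \<phi> (X \<omega>, \<xi> t \<omega>) \<partial>M) = (\<integral>\<omega>. (\<integral>x. \<phi> (X \<omega>, x) \<partial>P) \<partial>M)"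
proof -
  have XM [measurable]: "X \<in> borel_measurable M"
    by (rule measurable_from_subalg[OF subalgebra_hist X])
  let ?Q = "distr M borel X"
  interpret Q: prob_space ?Q by (rule M.prob_space_distr) measurable
  interpret QP: pair_sigma_finite ?Q P ..
  have m: "(\<lambda>\<omega>. (X \<omega>, \<xi> t \<omega>)) \<in> measurable M (borel \<Otimes>\<^sub>M P)" by measurable
  have eq: "?Q \<Otimes>\<^sub>M P = distr M (borel \<Otimes>\<^sub>M P) (\<lambda>\<omega>. (X \<omega>, \<xi> t \<omega>))"
  proof (rule pair_measure_eqI)
    fix A B assume A: "A \<in> sets ?Q" and B: "B \<in> sets P"
    have "emeasure ?Q A * emeasure P B
        = emeasure M (X -` A \<inter> space M) * emeasure M (\<xi> t -` B \<inter> space M)"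
    proof -
      have "emeasure P B = emeasure (distr M P (\<xi> t)) B" by (simp add: xi_distr)
      also have "\<dots> = emeasure M (\<xi> t -` B \<inter> space M)"
        using B by (intro emeasure_distr xi_meas)
      finally show ?thesis using A by (simp add: emeasure_distr)
    qed
    also have "\<dots> = emeasure M ((X -` A \<inter> space M) \<inter> (\<xi> t -` B \<inter> space M))"
    proof -
      have "X -` A \<inter> space M \<in> sets (hist t)"
        using A measurable_sets[OF X, of A] by simp
      moreover have "\<xi> t -` B \<inter> space M \<in> {\<xi> t -` A \<inter> space M | A. A \<in> sets P}"
        using B by blast
      ultimately show ?thesis
        by (simp add: M.emeasure_eq_measure M.indep_setD[OF xi_indep[of t]] ennreal_mult'')
    qed
    also have "\<dots> = emeasure (distr M (borel \<Otimes>\<^sub>M P) (\<lambda>\<omega>. (X \<omega>, \<xi> t \<omega>))) (A \<times> B)"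
      using A B by (subst emeasure_distr[OF m]) (auto intro!: arg_cong[where f = "emeasure M"])
    finally show "emeasure ?Q A * emeasure P B
        = emeasure (distr M (borel \<Otimes>\<^sub>M P) (\<lambda>\<omega>. (X \<omega>, \<xi> t \<omega>))) (A \<times> B)" .
  qed (unfold_locales, simp cong: sets_pair_measure_cong)
  have intQ: "integrable (?Q \<Otimes>\<^sub>M P) \<phi>"
    unfolding eq using int by (simp add: integrable_distr_eq[OF m \<phi>])
  have im: "(\<lambda>y. \<integral>x. \<phi> (y, x) \<partial>P) \<in> borel_measurable borel"
    using \<phi> by (intro P.borel_measurable_lebesgue_integral) (simp add: case_prod_unfold)
  have "integrable ?Q (\<lambda>y. \<integral>x. \<phi> (y, x) \<partial>P)"
    using QP.integrable_fst'[OF intQ] .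
  then show "integrable M (\<lambda>\<omega>. \<integral>x. \<phi> (X \<omega>, x) \<partial>P)"
    using im by (simp add: integrable_distr_eq[OF XM])
  have "(\<integral>\<omega>. \<phi> (X \<omega>, \<xi> t \<omega>) \<partial>M) = integral\<^sup>L (?Q \<Otimes>\<^sub>M P) \<phi>"
    unfolding eq by (simp add: integral_distr[OF m \<phi>])
  also have "\<dots> = (\<integral>y. (\<integral>x. \<phi> (y, x) \<partial>P) \<partial>?Q)"
    using QP.integral_fst'[OF intQ] by simp
  also have "\<dots> = (\<integral>\<omega>. (\<integral>x. \<phi> (X \<omega>, x) \<partial>P) \<partial>M)"
    using im by (simp add: integral_distr[OF XM])
  finally show "(\<integral>\<omega>. \<phi> (X \<omega>, \<xi> t \<omega>) \<partial>M) = (\<integral>\<omega>. (\<integral>x. \<phi> (X \<omega>, x) \<partial>P) \<partial>M)" .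
qed


section \<open>Recurrences for the expected read error, write error and lag\<close>

definition read_err :: "nat \<Rightarrow> real" where
  "read_err t = (\<integral>\<omega>. (norm (what t \<omega> - wstar))\<^sup>2 \<partial>M)"

definition write_err :: "nat \<Rightarrow> real" where
  "write_err t = (\<integral>\<omega>. (norm (w t \<omega> - wstar))\<^sup>2 \<partial>M)"

definition lag :: "nat \<Rightarrow> real" where
  "lag t = (\<integral>\<omega>. (norm (what t \<omega> - w t \<omega>))\<^sup>2 \<partial>M)"

lemma step_meas_hist': "(\<lambda>\<omega>. step (what t \<omega>) (\<xi> t \<omega>) k) \<in> borel_measurable (hist' t)"
  by (intro step_measurable hist_imp_hist'[OF hist_meas_what] hist'_meas_xi) simp

lemma sq_step_const: "square_integrable M (\<lambda>\<omega>. step (what t \<omega>) (\<xi> t \<omega>) k)"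
  by (intro sq_step) simp

text \<open>Averaging over the index leaves a single factor \<open>d\<xi> \<le> D\<close>, because
  the blocks are orthogonal. The gradient is then compared with the one at
  \<open>wstar\<close>.\<close>

lemma move_second_moment:
  "(\<integral>\<omega>. (norm (move t \<omega>))\<^sup>2 \<partial>M) \<le> real D * (2 * L\<^sup>2 * read_err t + N)"
proof -
  have "(\<integral>\<omega>. (norm (move t \<omega>))\<^sup>2 \<partial>M) = (\<integral>\<omega>. (\<Sum>k<d\<xi> (\<xi> t \<omega>).
      (norm (step (what t \<omega>) (\<xi> t \<omega>) k))\<^sup>2) / real (d\<xi> (\<xi> t \<omega>)) \<partial>M)"
  proof (rule uniform_index)
    show "(\<lambda>\<omega>. (norm (step (what t \<omega>) (\<xi> t \<omega>) k))\<^sup>2) \<in> borel_measurable (hist' t)" for k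
      using step_meas_hist'[of t k] by measurable
    show "integrable M (\<lambda>\<omega>. (norm (step (what t \<omega>) (\<xi> t \<omega>) k))\<^sup>2)" for k
      using sq_step_const by (simp add: square_integrable_def)
  qed (simp add: step_def)
  also have "\<dots> = (\<integral>\<omega>. real (d\<xi> (\<xi> t \<omega>)) * (norm (g (what t \<omega>) (\<xi> t \<omega>)))\<^sup>2 \<partial>M)"
    by (intro Bochner_Integration.integral_cong refl step_average xi_space)
  also have "\<dots> \<le> (\<integral>\<omega>. real D * (2 * L\<^sup>2 * (norm (what t \<omega> - wstar))\<^sup>2 + 2 * (norm (g wstar (\<xi> t \<omega>)))\<^sup>2) \<partial>M)"
  proof (rule integral_mono')
    show "integrable M (\<lambda>\<omega>. real D * (2 * L\<^sup>2 * (norm (what t \<omega> - wstar))\<^sup>2 + 2 * (norm (g wstar (\<xi> t \<omega>)))\<^sup>2))"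
      using sq_what[of t] g_wstar_xi by (simp add: square_integrable_def)
    fix \<omega> assume "\<omega> \<in> space M"
    then show "real (d\<xi> (\<xi> t \<omega>)) * (norm (g (what t \<omega>) (\<xi> t \<omega>)))\<^sup>2
      \<le> real D * (2 * L\<^sup>2 * (norm (what t \<omega> - wstar))\<^sup>2 + 2 * (norm (g wstar (\<xi> t \<omega>)))\<^sup>2)"
      using d_le_D by (intro mult_mono g_norm2_le xi_space) auto
  qed simp
  also have "\<dots> = real D * (2 * L\<^sup>2 * read_err t + N)"
    using sq_what[of t] g_wstar_xi[of t] by (simp add: square_integrable_def read_err_def)
  finally show ?thesis .
qed

text \<open>Cauchy-Schwarz over a window of at most \<open>\<tau> t\<close> updates gives the factor
  in front; the complement of a mask does not increase norms.\<close>

lemma lag_le: "lag t \<le> real (\<tau> t) * (\<Sum>j\<in>{t - \<tau> t..<t}. (\<eta> j)\<^sup>2 * (real D * (2 * L\<^sup>2 * read_err j + N)))"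
proof -
  have int: "integrable M (\<lambda>\<omega>. (norm (move j \<omega>))\<^sup>2)" for j
    using sq_step[OF u_meas] by (simp add: square_integrable_def)
  have "lag t \<le> (\<integral>\<omega>. real (\<tau> t) * (\<Sum>j\<in>{t - \<tau> t..<t}. (\<eta> j)\<^sup>2 * (norm (move j \<omega>))\<^sup>2) \<partial>M)"
    unfolding lag_def
  proof (rule integral_mono')
    fix \<omega> assume "\<omega> \<in> space M"
    then have "(norm (what t \<omega> - w t \<omega>))\<^sup>2 \<le> real (card {t - \<tau> t..<t}) *
        (\<Sum>j\<in>{t - \<tau> t..<t}. (norm (\<eta> j *\<^sub>R (move j \<omega> - diag01 (\<Sigma> t j \<omega>) *v move j \<omega>)))\<^sup>2)"
      by (simp only: what_minus_w norm_sum_power2_le)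
    also have "\<dots> \<le> real (\<tau> t) * (\<Sum>j\<in>{t - \<tau> t..<t}. (\<eta> j)\<^sup>2 * (norm (move j \<omega>))\<^sup>2)"
    proof (intro mult_mono sum_mono sum_nonneg)
      show "(norm (\<eta> j *\<^sub>R (move j \<omega> - diag01 (\<Sigma> t j \<omega>) *v move j \<omega>)))\<^sup>2
          \<le> (\<eta> j)\<^sup>2 * (norm (move j \<omega>))\<^sup>2" for j
        using norm_diff_diag01_mult_vec_le
        by (auto simp: power_mult_distrib intro!: mult_left_mono power_mono)
    qed auto
    finally show "(norm (what t \<omega> - w t \<omega>))\<^sup>2
        \<le> real (\<tau> t) * (\<Sum>j\<in>{t - \<tau> t..<t}. (\<eta> j)\<^sup>2 * (norm (move j \<omega>))\<^sup>2)" .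
  qed (use int in \<open>auto intro!: mult_nonneg_nonneg sum_nonneg\<close>)
  also have "\<dots> = real (\<tau> t) * (\<Sum>j\<in>{t - \<tau> t..<t}. (\<eta> j)\<^sup>2 * (\<integral>\<omega>. (norm (move j \<omega>))\<^sup>2 \<partial>M))"
    using int by simp
  also have "\<dots> \<le> real (\<tau> t) * (\<Sum>j\<in>{t - \<tau> t..<t}. (\<eta> j)\<^sup>2 * (real D * (2 * L\<^sup>2 * read_err j + N)))"
    by (intro mult_left_mono sum_mono move_second_moment) auto
  finally show ?thesis .
qed

lemma read_err_le: "read_err t \<le> 2 * write_err t + 2 * lag t"
proof -
  have "read_err t \<le> (\<integral>\<omega>. 2 * (norm (w t \<omega> - wstar))\<^sup>2 + 2 * (norm (what t \<omega> - w t \<omega>))\<^sup>2 \<partial>M)"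
    unfolding read_err_def
  proof (rule integral_mono')
    show "(norm (what t \<omega> - wstar))\<^sup>2 \<le> 2 * (norm (w t \<omega> - wstar))\<^sup>2 + 2 * (norm (what t \<omega> - w t \<omega>))\<^sup>2" for \<omega>
      using norm_add_power2_le[of "w t \<omega> - wstar" "what t \<omega> - w t \<omega>"] by simp
  qed (use sq_w[of t] sq_diff[of t] in \<open>auto simp: square_integrable_def\<close>)
  then show ?thesis
    using sq_w[of t] sq_diff[of t] by (simp add: square_integrable_def write_err_def lag_def)
qed

text \<open>The squared distance is expanded and averaged in two stages: first over the index
  \<open>u t\<close> given the history and the sample, then over the sample with the pair of read
  and iterate frozen. The inner average is the left-hand side of
  \<open>expected_step\<close>.\<close>

lemma write_err_Suc:
  "write_err (Suc t) \<le> (1 - \<mu> * \<eta> t / 2) * write_err t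
    + ((L + \<mu>) * \<eta> t + 2 * L\<^sup>2 * (\<eta> t)\<^sup>2 * real D) * lag t + 2 * (\<eta> t)\<^sup>2 * real D * N"
proof -
  let ?d = "\<lambda>\<omega>. d\<xi> (\<xi> t \<omega>)" and ?g = "\<lambda>\<omega>. g (what t \<omega>) (\<xi> t \<omega>)"
  let ?U = "\<lambda>\<omega>. w t \<omega> - wstar" and ?st = "\<lambda>k \<omega>. step (what t \<omega>) (\<xi> t \<omega>) k"
  \<comment> \<open>\<open>X k\<close> is the change of the squared distance if block
    \<open>k\<close> is chosen. It vanishes where \<open>d\<xi>\<close> is 0, as
    \<open>uniform_index\<close> demands.\<close>
  define X where "X = (\<lambda>k \<omega>. (\<eta> t)\<^sup>2 * (norm (?st k \<omega>))\<^sup>2 - 2 * \<eta> t * (?U \<omega> \<bullet> ?st k \<omega>))"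
  have U: "integrable M (\<lambda>\<omega>. (norm (?U \<omega>))\<^sup>2)"
    using sq_w[of t] by (simp add: square_integrable_def)
  have g2: "integrable M (\<lambda>\<omega>. (norm (?g \<omega>))\<^sup>2)"
    using sq_g[of t] by (simp add: square_integrable_def)
  have Ug: "integrable M (\<lambda>\<omega>. ?U \<omega> \<bullet> ?g \<omega>)"
    by (rule square_integrable_inner[OF sq_w sq_g])
  have Xu: "integrable M (\<lambda>\<omega>. X (u t \<omega>) \<omega>)"
    unfolding X_def using sq_step[OF u_meas, of t t] square_integrable_inner[OF sq_w[of t] sq_step[OF u_meas, of t t]]
    by (simp add: square_integrable_def)
  have "write_err (Suc t) = (\<integral>\<omega>. (norm (?U \<omega>))\<^sup>2 + X (u t \<omega>) \<omega> \<partial>M)"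
    unfolding write_err_def
  proof (intro Bochner_Integration.integral_cong refl)
    fix \<omega> assume \<omega>: "\<omega> \<in> space M"
    have "w (Suc t) \<omega> - wstar = ?U \<omega> - \<eta> t *\<^sub>R move t \<omega>"
      using w_step[OF \<omega>] by simp
    then show "(norm (w (Suc t) \<omega> - wstar))\<^sup>2 = (norm (?U \<omega>))\<^sup>2 + X (u t \<omega>) \<omega>"
      by (simp only: X_def power2_norm_eq_inner inner_diff_left inner_diff_right
          inner_scaleR_left inner_scaleR_right inner_commute[of "move t \<omega>" "w t \<omega>"]
          inner_commute[of "move t \<omega>" wstar]) (simp add: power2_eq_square algebra_simps)
  qed
  also have "\<dots> = (\<integral>\<omega>. (norm (?U \<omega>))\<^sup>2 \<partial>M) + (\<integral>\<omega>. X (u t \<omega>) \<omega> \<partial>M)"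
    using U Xu by simp
  also have "(\<integral>\<omega>. X (u t \<omega>) \<omega> \<partial>M) = (\<integral>\<omega>. (\<Sum>k<?d \<omega>. X k \<omega>) / real (?d \<omega>) \<partial>M)"
  proof (rule uniform_index)
    fix k
    note step_meas_hist'[of t k, measurable] hist_imp_hist'[OF hist_meas_w, of t, measurable]
    show "X k \<in> borel_measurable (hist' t)"
      unfolding X_def by measurable
    show "integrable M (X k)"
      unfolding X_def using sq_step_const[of t k] square_integrable_inner[OF sq_w[of t] sq_step_const[of t k]]
      by (simp add: square_integrable_def)
  qed (simp add: X_def step_def)
  \<comment> \<open>The number of filters depends on the same sample as the gradient, so it is
    bounded by \<open>D\<close> before the sample is averaged out.\<close>
  also have "\<dots> \<le> (\<integral>\<omega>. (\<eta> t)\<^sup>2 * real D * (norm (?g \<omega>))\<^sup>2 - 2 * \<eta> t * (?U \<omega> \<bullet> ?g \<omega>) \<partial>M)"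
  proof -
    have "(\<Sum>k<?d \<omega>. X k \<omega>) / real (?d \<omega>)
        = (\<eta> t)\<^sup>2 * (real (?d \<omega>) * (norm (?g \<omega>))\<^sup>2) - 2 * \<eta> t * (?U \<omega> \<bullet> ?g \<omega>)"
      if "\<omega> \<in> space M" for \<omega>
    proof -
      have "(\<Sum>k<?d \<omega>. X k \<omega>) / real (?d \<omega>)
        = (\<eta> t)\<^sup>2 * ((\<Sum>k<?d \<omega>. (norm (?st k \<omega>))\<^sup>2) / real (?d \<omega>))
          - 2 * \<eta> t * (?U \<omega> \<bullet> ((\<Sum>k<?d \<omega>. ?st k \<omega>) /\<^sub>R real (?d \<omega>)))"
        unfolding X_def sum_subtractf sum_distrib_left[symmetric] inner_sum_right[symmetric]
        by (simp add: divide_inverse algebra_simps)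
      then show ?thesis
        by (simp only: step_average[OF xi_space[OF that]])
    qed
    then have "(\<integral>\<omega>. (\<Sum>k<?d \<omega>. X k \<omega>) / real (?d \<omega>) \<partial>M)
        = (\<integral>\<omega>. (\<eta> t)\<^sup>2 * (real (?d \<omega>) * (norm (?g \<omega>))\<^sup>2) - 2 * \<eta> t * (?U \<omega> \<bullet> ?g \<omega>) \<partial>M)"
      by (intro Bochner_Integration.integral_cong refl)
    also have "\<dots> \<le> (\<integral>\<omega>. (\<eta> t)\<^sup>2 * real D * (norm (?g \<omega>))\<^sup>2 - 2 * \<eta> t * (?U \<omega> \<bullet> ?g \<omega>) \<partial>M)"
    proof (rule integral_mono)
      have "integrable M (\<lambda>\<omega>. real (?d \<omega>) * (norm (?g \<omega>))\<^sup>2)"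
      proof (rule Bochner_Integration.integrable_bound)
        show "integrable M (\<lambda>\<omega>. real D * (norm (?g \<omega>))\<^sup>2)" using g2 by simp
      qed (use d_le_D in \<open>auto intro!: mult_right_mono\<close>)
      then show "integrable M (\<lambda>\<omega>. (\<eta> t)\<^sup>2 * (real (?d \<omega>) * (norm (?g \<omega>))\<^sup>2) - 2 * \<eta> t * (?U \<omega> \<bullet> ?g \<omega>))"
        using Ug by simp
      show "integrable M (\<lambda>\<omega>. (\<eta> t)\<^sup>2 * real D * (norm (?g \<omega>))\<^sup>2 - 2 * \<eta> t * (?U \<omega> \<bullet> ?g \<omega>))"
        using Ug g2 by simp
      show "(\<eta> t)\<^sup>2 * (real (?d \<omega>) * (norm (?g \<omega>))\<^sup>2) - 2 * \<eta> t * (?U \<omega> \<bullet> ?g \<omega>)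
        \<le> (\<eta> t)\<^sup>2 * real D * (norm (?g \<omega>))\<^sup>2 - 2 * \<eta> t * (?U \<omega> \<bullet> ?g \<omega>)" for \<omega>
        using d_le_D[of "\<xi> t \<omega>"] by (simp add: mult.assoc mult_left_mono mult_right_mono)
    qed
    finally show ?thesis .
  qed
  also have "(\<integral>\<omega>. (norm (?U \<omega>))\<^sup>2 \<partial>M) +
      (\<integral>\<omega>. (\<eta> t)\<^sup>2 * real D * (norm (?g \<omega>))\<^sup>2 - 2 * \<eta> t * (?U \<omega> \<bullet> ?g \<omega>) \<partial>M)
    = (\<integral>\<omega>. (norm (?U \<omega>))\<^sup>2 + (\<eta> t)\<^sup>2 * real D * (norm (?g \<omega>))\<^sup>2 - 2 * \<eta> t * (?U \<omega> \<bullet> ?g \<omega>) \<partial>M)"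
    using U g2 Ug by simp
  also have "\<dots> \<le> (\<integral>\<omega>. (1 - \<mu> * \<eta> t / 2) * (norm (?U \<omega>))\<^sup>2
      + ((L + \<mu>) * \<eta> t + 2 * L\<^sup>2 * (\<eta> t)\<^sup>2 * real D) * (norm (what t \<omega> - w t \<omega>))\<^sup>2
      + 2 * (\<eta> t)\<^sup>2 * real D * N \<partial>M)"
  proof -
    define \<phi> :: "((real ^ 'd) \<times> (real ^ 'd)) \<times> 'x \<Rightarrow> real" where
      "\<phi> = (\<lambda>p. (norm (snd (fst p) - wstar))\<^sup>2 + (\<eta> t)\<^sup>2 * real D * (norm (g (fst (fst p)) (snd p)))\<^sup>2
        - 2 * \<eta> t * ((snd (fst p) - wstar) \<bullet> g (fst (fst p)) (snd p)))"
    \<comment> \<open>The pair of read and iterate carries the Borel sigma-algebra of the product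
      space, so the projections are measurable by continuity.\<close>
    have c1: "fst \<in> borel_measurable (borel :: ((real ^ 'd) \<times> (real ^ 'd)) measure)"
      by (intro borel_measurable_continuous_onI continuous_intros)
    have c2: "snd \<in> borel_measurable (borel :: ((real ^ 'd) \<times> (real ^ 'd)) measure)"
      by (intro borel_measurable_continuous_onI continuous_intros)
    have [measurable]: "(\<lambda>p. fst (fst p)) \<in> borel_measurable
        ((borel :: ((real ^ 'd) \<times> (real ^ 'd)) measure) \<Otimes>\<^sub>M P)"
      by (rule measurable_compose[OF measurable_fst c1])
    have [measurable]: "(\<lambda>p. snd (fst p)) \<in> borel_measurable
        ((borel :: ((real ^ 'd) \<times> (real ^ 'd)) measure) \<Otimes>\<^sub>M P)"
      by (rule measurable_compose[OF measurable_fst c2])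
    have [measurable]: "(\<lambda>p. g (fst (fst p)) (snd p)) \<in> borel_measurable
        ((borel :: ((real ^ 'd) \<times> (real ^ 'd)) measure) \<Otimes>\<^sub>M P)"
      using measurable_compose[OF measurable_Pair[OF measurable_compose[OF measurable_fst c1] measurable_snd]
          g_joint_meas] by simp
    have \<phi>m: "\<phi> \<in> borel_measurable (borel \<Otimes>\<^sub>M P)"
      unfolding \<phi>_def by measurable
    have X: "(\<lambda>\<omega>. (what t \<omega>, w t \<omega>)) \<in> borel_measurable (hist t)"
      by (intro borel_measurable_Pair hist_meas_what hist_meas_w)
    have \<phi>i: "integrable M (\<lambda>\<omega>. \<phi> ((what t \<omega>, w t \<omega>), \<xi> t \<omega>))"
      unfolding \<phi>_def using U g2 Ug by simp
    have inner: "(\<integral>x. \<phi> ((v', v), x) \<partial>P) = (norm (v - wstar))\<^sup>2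
        + (\<eta> t)\<^sup>2 * real D * (\<integral>x. (norm (g v' x))\<^sup>2 \<partial>P) - 2 * \<eta> t * ((v - wstar) \<bullet> gradient F v')" for v v'
      unfolding \<phi>_def using g_norm2_int g_int by (simp add: P.prob_space g_unbiased)
    have "(\<integral>\<omega>. (norm (?U \<omega>))\<^sup>2 + (\<eta> t)\<^sup>2 * real D * (norm (?g \<omega>))\<^sup>2 - 2 * \<eta> t * (?U \<omega> \<bullet> ?g \<omega>) \<partial>M)
        = (\<integral>\<omega>. \<phi> ((what t \<omega>, w t \<omega>), \<xi> t \<omega>) \<partial>M)"
      by (simp add: \<phi>_def)
    also have "\<dots> = (\<integral>\<omega>. (\<integral>x. \<phi> ((what t \<omega>, w t \<omega>), x) \<partial>P) \<partial>M)"
      by (rule expectation_independent(2)[OF X \<phi>m \<phi>i])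
    also have "\<dots> \<le> (\<integral>\<omega>. (1 - \<mu> * \<eta> t / 2) * (norm (?U \<omega>))\<^sup>2
      + ((L + \<mu>) * \<eta> t + 2 * L\<^sup>2 * (\<eta> t)\<^sup>2 * real D) * (norm (what t \<omega> - w t \<omega>))\<^sup>2
      + 2 * (\<eta> t)\<^sup>2 * real D * N \<partial>M)"
    proof (rule integral_mono)
      show "integrable M (\<lambda>\<omega>. \<integral>x. \<phi> ((what t \<omega>, w t \<omega>), x) \<partial>P)"
        by (rule expectation_independent(1)[OF X \<phi>m \<phi>i])
      show "integrable M (\<lambda>\<omega>. (1 - \<mu> * \<eta> t / 2) * (norm (?U \<omega>))\<^sup>2
        + ((L + \<mu>) * \<eta> t + 2 * L\<^sup>2 * (\<eta> t)\<^sup>2 * real D) * (norm (what t \<omega> - w t \<omega>))\<^sup>2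
        + 2 * (\<eta> t)\<^sup>2 * real D * N)"
        using U sq_diff[of t] by (simp add: square_integrable_def)
    qed (unfold inner, rule expected_step[OF eta_nonneg eta_small])
    finally show ?thesis .
  qed
  also have "\<dots> = (1 - \<mu> * \<eta> t / 2) * write_err t
    + ((L + \<mu>) * \<eta> t + 2 * L\<^sup>2 * (\<eta> t)\<^sup>2 * real D) * lag t + 2 * (\<eta> t)\<^sup>2 * real D * N"
    using U sq_diff[of t] by (simp add: square_integrable_def write_err_def lag_def M.prob_space)
  finally show ?thesis by simp
qed

lemma
  shows read_err_nonneg: "0 \<le> read_err t" and write_err_nonneg: "0 \<le> write_err t"
    and lag_nonneg: "0 \<le> lag t"
  by (simp_all add: read_err_def write_err_def lag_def)


section \<open>Asymptotics of the errors\<close>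

lemma asymptotic_bounds:
  assumes eta_lo: "\<And>t. 12 / (\<mu> * (real t + 2 * real (\<tau> t))) \<le> \<eta> t"
    and eta_hi: "\<And>t. \<eta> t \<le> \<alpha> / (\<mu> * (real t + 2 * real (\<tau> t)))"
    and alpha: "0 \<le> \<alpha>"
    and tau: "\<forall>\<^sub>F t in sequentially. real (\<tau> t) \<le> sqrt (real t * delay_fun (real t))"
  shows "\<exists>C\<ge>0. \<forall>\<^sub>F t in sequentially.
      write_err t \<le> 2 * \<alpha>\<^sup>2 * real D * N / \<mu>\<^sup>2 / real t + C / (real t * ln (real t)) \<and>
      lag t \<le> C / (real t * ln (real t))"
proof -
  \<comment> \<open>\<open>K1\<close> comes from the lag: the step sizes in the window are at most
    \<open>2 * \<alpha> / (\<mu> * real t)\<close>, and the square of the 2 is the 4.\<close>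
  define K1 where "K1 = 4 * real D * \<alpha>\<^sup>2 * (2 * L\<^sup>2 + N) / \<mu>\<^sup>2"
  \<comment> \<open>\<open>K2\<close> comes from the coefficient of the lag in
    \<open>write_err_Suc\<close>: its quadratic part is at most \<open>L * \<eta> t\<close> since
    step sizes are small, and \<open>\<eta> t\<close> is at most
    \<open>\<alpha> / (\<mu> * real t)\<close>.\<close>
  define K2 where "K2 = (2 * L + \<mu>) * \<alpha> / \<mu>"
  have K1: "0 \<le> K1" unfolding K1_def using N_nonneg by simp
  have K2: "0 \<le> K2" unfolding K2_def using L_pos mu_pos alpha by simp
  have eta_t: "\<eta> t \<le> \<alpha> / (\<mu> * c)" if "0 < c" "c \<le> real t" for t c
  proof -
    have "\<eta> t \<le> \<alpha> / (\<mu> * (real t + 2 * real (\<tau> t)))" by (rule eta_hi)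
    also have "\<dots> \<le> \<alpha> / (\<mu> * c)"
      using that alpha mu_pos by (intro divide_left_mono mult_left_mono) auto
    finally show ?thesis .
  qed
  \<comment> \<open>The bound on the squared delay supplies the logarithm in the rate of the lag.
    The bound \<open>real t / 4\<close>, valid because \<open>t \<le> (t/4)^2\<close> from 16 on,
    keeps the window above \<open>real t / 2\<close> and the denominator
    \<open>t + 2 \<tau>(t)\<close> below \<open>3 t / 2\<close>.\<close>
  have small: "\<forall>\<^sub>F t in sequentially. 16 \<le> t \<and> (real (\<tau> t))\<^sup>2 \<le> real t / ln (real t) \<and> real (\<tau> t) \<le> real t / 4"
    using tau eventually_ge_at_top[of 16]
  proof eventually_elim
    case (elim t)
    have t16: "16 \<le> real t" using elim by simp
    have ln1: "1 \<le> ln (real t)"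
    proof -
      have "exp 1 \<le> real t" using exp_le t16 by linarith
      then show ?thesis using t16 by (simp add: ln_ge_iff)
    qed
    then have "0 \<le> delay_fun (real t)"
      by (simp add: delay_fun_def power2_eq_square divide_left_mono)
    then have "(real (\<tau> t))\<^sup>2 \<le> real t * delay_fun (real t)"
      using elim by (metis mult_nonneg_nonneg of_nat_0_le_iff power_mono real_sqrt_pow2)
    also have "\<dots> \<le> real t * (1 / ln (real t))"
      by (intro mult_left_mono) (auto simp: delay_fun_def)
    finally have sq: "(real (\<tau> t))\<^sup>2 \<le> real t / ln (real t)" by simp
    also have "\<dots> \<le> real t / 1"
      using ln1 by (intro divide_left_mono) auto
    also have "\<dots> \<le> (real t / 4)\<^sup>2"
      using mult_right_mono[OF t16, of "real t"] by (simp add: power2_eq_square)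
    finally have "real (\<tau> t) \<le> real t / 4"
      by (rule power2_le_imp_le) simp
    with sq elim show ?case by simp
  qed
  show ?thesis
  proof (rule delayed_recurrence[where K = "K1 + K2" and e = read_err])
    show "\<forall>\<^sub>F t in sequentially. \<forall>B. (\<forall>j<t. read_err j \<le> B) \<longrightarrow>
        lag t \<le> (K1 + K2) * (1 + B) / (real t * ln (real t))"
      using small
    proof (eventually_elim, intro allI impI)
      fix t B assume t: "16 \<le> t \<and> (real (\<tau> t))\<^sup>2 \<le> real t / ln (real t) \<and> real (\<tau> t) \<le> real t / 4"
        and B: "\<forall>j<t. read_err j \<le> B"
      have t0: "0 < real t" using t by simp
      have B0: "0 \<le> B" using B t read_err_nonneg[of 0] by (meson less_le_trans order.trans zero_less_numeral)
      define c where "c = (2 * \<alpha> / (\<mu> * real t))\<^sup>2 * (real D * ((2 * L\<^sup>2 + N) * (1 + B)))"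
      have c0: "0 \<le> c" unfolding c_def using N_nonneg B0 by simp
      have "lag t \<le> real (\<tau> t) * (\<Sum>j\<in>{t - \<tau> t..<t}. (\<eta> j)\<^sup>2 * (real D * (2 * L\<^sup>2 * read_err j + N)))"
        by (rule lag_le)
      also have "\<dots> \<le> real (\<tau> t) * (\<Sum>j\<in>{t - \<tau> t..<t}. c)"
      proof (intro mult_left_mono sum_mono)
        fix j assume j: "j \<in> {t - \<tau> t..<t}"
        have "real t / 2 \<le> real j" using j t by auto
        then have "\<eta> j \<le> 2 * \<alpha> / (\<mu> * real t)"
          using eta_t[of "real t / 2" j] t0 by (simp add: field_simps)
        moreover have "2 * L\<^sup>2 * read_err j + N \<le> (2 * L\<^sup>2 + N) * (1 + B)"
        proof -
          have "2 * L\<^sup>2 * read_err j \<le> 2 * L\<^sup>2 * B" using B j by (intro mult_left_mono) auto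
          moreover have "0 \<le> N * B" using N_nonneg B0 by simp
          moreover have "0 \<le> L\<^sup>2" by simp
          ultimately show ?thesis unfolding distrib_left distrib_right by linarith
        qed
        ultimately show "(\<eta> j)\<^sup>2 * (real D * (2 * L\<^sup>2 * read_err j + N)) \<le> c"
          unfolding c_def using eta_nonneg[of j] read_err_nonneg[of j] N_nonneg
          by (intro mult_mono power_mono) auto
      qed simp
      also have "\<dots> \<le> real (\<tau> t) * (real (\<tau> t) * c)"
        using c0 by (intro mult_left_mono) (auto intro!: mult_right_mono)
      also have "\<dots> = (real (\<tau> t))\<^sup>2 * c" by (simp add: power2_eq_square)
      also have "\<dots> \<le> real t / ln (real t) * c"
        using t c0 by (intro mult_right_mono) auto
      also have "\<dots> = K1 * (1 + B) / (real t * ln (real t))"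
        using t0 by (simp add: c_def K1_def power2_eq_square mult_ac)
      also have "\<dots> \<le> (K1 + K2) * (1 + B) / (real t * ln (real t))"
        using K2 B0 t by (intro divide_right_mono mult_right_mono) auto
      finally show "lag t \<le> (K1 + K2) * (1 + B) / (real t * ln (real t))" .
    qed
    show "\<forall>\<^sub>F t in sequentially. write_err (t + 1) \<le> (1 - 4 / real t) * write_err t
        + (K1 + K2) / real t * lag t + 2 * \<alpha>\<^sup>2 * real D * N / \<mu>\<^sup>2 / (real t)\<^sup>2"
      using small
    proof eventually_elim
      case (elim t)
      then have t0: "0 < real t" by simp
      have eta: "\<eta> t \<le> \<alpha> / (\<mu> * real t)" using eta_t[of "real t" t] t0 by simp
      \<comment> \<open>This is where 12 matters: half of it over a denominator of at most
        \<open>3 t / 2\<close> gives the contraction \<open>4 / t\<close> that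
        \<open>delayed_recurrence\<close> expects.\<close>
      have "4 / real t \<le> 6 / (real t + 2 * real (\<tau> t))"
        using elim t0 by (simp add: field_simps)
      also have "\<dots> = \<mu> * (12 / (\<mu> * (real t + 2 * real (\<tau> t)))) / 2"
      proof -
        have "6 / s = \<mu> * (12 / (\<mu> * s)) / 2" for s using mu_pos by simp
        then show ?thesis .
      qed
      also have "\<dots> \<le> \<mu> * \<eta> t / 2"
        using mu_pos eta_lo by (intro divide_right_mono mult_left_mono) auto
      finally have 1: "(1 - \<mu> * \<eta> t / 2) * write_err t \<le> (1 - 4 / real t) * write_err t"
        using write_err_nonneg by (intro mult_right_mono) auto
      have "2 * L\<^sup>2 * (\<eta> t)\<^sup>2 * real D = 2 * L * real D * \<eta> t * (L * \<eta> t)"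
        by (simp add: power2_eq_square)
      also have "\<dots> \<le> 1 * (L * \<eta> t)"
      proof (intro mult_right_mono)
        have "2 * L * real D * \<eta> t \<le> 2 * L * real D * (1 / (4 * L * real D))"
          using L_pos eta_small by (intro mult_left_mono) auto
        then show "2 * L * real D * \<eta> t \<le> 1"
          using L_pos D_ge1 by simp
      qed (use L_pos eta_nonneg in auto)
      finally have "(L + \<mu>) * \<eta> t + 2 * L\<^sup>2 * (\<eta> t)\<^sup>2 * real D \<le> (2 * L + \<mu>) * \<eta> t"
        by (simp add: algebra_simps)
      also have "\<dots> \<le> (2 * L + \<mu>) * (\<alpha> / (\<mu> * real t))"
        using eta L_pos mu_pos by (intro mult_left_mono) auto
      also have "\<dots> = K2 / real t" by (simp add: K2_def)
      also have "\<dots> \<le> (K1 + K2) / real t" using K1 by (intro divide_right_mono) auto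
      finally have 2: "((L + \<mu>) * \<eta> t + 2 * L\<^sup>2 * (\<eta> t)\<^sup>2 * real D) * lag t \<le> (K1 + K2) / real t * lag t"
        using lag_nonneg by (intro mult_right_mono)
      have "2 * (\<eta> t)\<^sup>2 * real D * N \<le> 2 * (\<alpha> / (\<mu> * real t))\<^sup>2 * real D * N"
        using eta eta_nonneg N_nonneg by (intro mult_right_mono mult_left_mono power_mono) auto
      also have "\<dots> = 2 * \<alpha>\<^sup>2 * real D * N / \<mu>\<^sup>2 / (real t)\<^sup>2"
        by (simp add: power_divide power_mult_distrib)
      finally show ?case
        using 1 2 write_err_Suc[of t] by simp
    qed
  qed (use K1 K2 N_nonneg read_err_nonneg write_err_nonneg read_err_le in auto)
qed

end

section \<open>From eventual bounds to the stated form\<close>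

lemma bound_with_remainder:
  fixes b :: "nat \<Rightarrow> real"
  assumes C: "0 \<le> C" and A: "0 \<le> A"
    and b: "\<forall>\<^sub>F t in sequentially. b t \<le> A / real t + C / (real t * ln (real t))"
  shows "\<exists>r. r \<in> O(\<lambda>t. 1 / (real t * ln (real t))) \<and> (\<forall>t\<ge>1. b (t + 1) \<le> A * (1 / real t) + r t)"
proof -
  \<comment> \<open>As the positive part of the excess, \<open>r\<close> makes the bound true for
    every \<open>t \<ge> 1\<close>; only its order of growth remains to be shown, and that is an
    eventual statement.\<close>
  define r where "r = (\<lambda>t. max 0 (b (t + 1) - A * (1 / real t)))"
  have "\<forall>\<^sub>F t in sequentially. norm (r t) \<le> C * norm (1 / (real t * ln (real t)))"
    \<comment> \<open>The bound is used at \<open>t + 1\<close> and weakened to \<open>t\<close>;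
      from 2 on the logarithms are positive.\<close>
    using eventually_sequentially_Suc[THEN iffD2, OF b] eventually_ge_at_top[of 2]
  proof eventually_elim
    case (elim t)
    have l: "0 < ln (real t)" "ln (real t) \<le> ln (real (Suc t))" using elim by auto
    have "b (t + 1) \<le> A / real (Suc t) + C / (real (Suc t) * ln (real (Suc t)))"
      using elim by simp
    also have "A / real (Suc t) \<le> A * (1 / real t)"
      using A elim by (simp add: frac_le)
    also have "C / (real (Suc t) * ln (real (Suc t))) \<le> C / (real t * ln (real t))"
      using C l elim by (intro divide_left_mono mult_mono mult_pos_pos) auto
    finally show ?case using C l elim by (simp add: r_def)
  qed
  then have "r \<in> O(\<lambda>t. 1 / (real t * ln (real t)))"
    by (rule bigoI)
  then show ?thesis
    by (intro exI[of _ r]) (auto simp: r_def)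
qed

theorem lemma11:
  fixes M :: "'a measure" and P :: "'x measure"
    and f :: "real ^ 'd::finite \<Rightarrow> 'x \<Rightarrow> real" and F :: "real ^ 'd \<Rightarrow> real"
    and S :: "'x \<Rightarrow> nat \<Rightarrow> 'd set" and D :: nat
    and \<xi> :: "nat \<Rightarrow> 'a \<Rightarrow> 'x" and u :: "nat \<Rightarrow> 'a \<Rightarrow> nat"
    and \<Sigma> :: "nat \<Rightarrow> nat \<Rightarrow> 'a \<Rightarrow> 'd set"
    and w what :: "nat \<Rightarrow> 'a \<Rightarrow> real ^ 'd" and w0 wstar :: "real ^ 'd"
    and \<tau> :: "nat \<Rightarrow> nat" and \<eta> a :: "nat \<Rightarrow> real" and \<alpha> \<mu> L N :: real
    and g :: "real ^ 'd \<Rightarrow> 'x \<Rightarrow> real ^ 'd" and d\<xi> :: "'x \<Rightarrow> nat"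
  defines "g \<equiv> (\<lambda>v x. gradient (\<lambda>v'. f v' x) v)"
    and "d\<xi> \<equiv> (\<lambda>x. num_filters D (card (grad_support (\<lambda>v. f v x))))"
  \<comment> \<open>objective\<close>
  assumes prob_M: "prob_space M" and prob_P: "prob_space P"
    and f_diff: "\<And>x v. x \<in> space P \<Longrightarrow> (\<lambda>v'. f v' x) differentiable (at v)"
    and f_int: "\<And>v. integrable P (f v)"
    and F_def: "\<And>v. F v = (\<integral>x. f v x \<partial>P)"
    and F_diff: "\<And>v. F differentiable (at v)"
    and g_int: "\<And>v. integrable P (g v)"
    and g_unbiased: "\<And>v. (\<integral>x. g v x \<partial>P) = gradient F v"
    and mu_pos: "\<mu> > 0" and F_sc: "strongly_convex \<mu> F"
    and L_pos: "L > 0" and f_smooth: "\<And>x. x \<in> space P \<Longrightarrow> L_smooth L (\<lambda>v. f v x)"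
    and f_convex: "\<And>x. x \<in> space P \<Longrightarrow> gradient_convex (\<lambda>v. f v x)"
    and minimizer: "\<And>v. F wstar \<le> F v"
    and N_fin: "integrable P (\<lambda>x. (norm (g wstar x))\<^sup>2)"
    and N_def: "N = 2 * (\<integral>x. (norm (g wstar x))\<^sup>2 \<partial>P)"
  \<comment> \<open>filters\<close>
    and D_ge1: "D \<ge> 1"
    and S_part: "\<And>x. x \<in> space P \<Longrightarrow> filter_partition D (grad_support (\<lambda>v. f v x)) (S x)"
    and S_meas: "\<And>k. (\<lambda>x. S x k) \<in> measurable P (count_space UNIV)"
  \<comment> \<open>sampling\<close>
    and xi_iid: "prob_space.indep_vars M (\<lambda>_. P) \<xi> UNIV" "\<And>t. distr M P (\<xi> t) = P"
    and u_meas: "\<And>t. u t \<in> measurable M (count_space UNIV)"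
    and mask_meas: "\<And>t j. j \<in> {t - \<tau> t..<t} \<Longrightarrow> \<Sigma> t j \<in> measurable M (count_space UNIV)"
    and xi_indep: "\<And>t. prob_space.indep_set M
        (sets (history M P w \<xi> u \<Sigma> \<tau> t)) {\<xi> t -` A \<inter> space M | A. A \<in> sets P}"
    and u_unif: "\<And>t k. AE \<omega> in M. k < d\<xi> (\<xi> t \<omega>) \<longrightarrow>
        real_cond_exp M (adjoin (history M P w \<xi> u \<Sigma> \<tau> t) (\<xi> t) P)
          (indicator {\<omega> \<in> space M. u t \<omega> = k}) \<omega> = 1 / real (d\<xi> (\<xi> t \<omega>))"
  \<comment> \<open>recursion and delayed reads\<close>
    and w_0: "\<And>\<omega>. \<omega> \<in> space M \<Longrightarrow> w 0 \<omega> = w0"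
    and w_Suc: "\<And>t \<omega>. \<omega> \<in> space M \<Longrightarrow> w (t + 1) \<omega> = w t \<omega> -
        (\<eta> t * real (d\<xi> (\<xi> t \<omega>))) *\<^sub>R (diag01 (S (\<xi> t \<omega>) (u t \<omega>)) *v g (what t \<omega>) (\<xi> t \<omega>))"
    and consistent: "\<And>t \<omega>. \<omega> \<in> space M \<Longrightarrow> what t \<omega> = w (t - \<tau> t) \<omega> -
        (\<Sum>j\<in>{t - \<tau> t..<t}. (\<eta> j * real (d\<xi> (\<xi> j \<omega>))) *\<^sub>R
          (diag01 (\<Sigma> t j \<omega>) *v (diag01 (S (\<xi> j \<omega>) (u j \<omega>)) *v g (what j \<omega>) (\<xi> j \<omega>))))"
  \<comment> \<open>delay and step sizes\<close>
    and tau_mono: "mono \<tau>"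
    and tau_lower: "\<And>t. 2 * L * \<alpha> * real D / \<mu> \<le> real (\<tau> t)"
    and tau_upper: "\<forall>\<^sub>F t in sequentially. real (\<tau> t) \<le> sqrt (real t * delay_fun (real t))"
    and eta_def: "\<And>t. \<eta> t = a t / (\<mu> * (real t + 2 * real (\<tau> t)))"
    and a_bounds: "\<And>t. 12 \<le> a t" "\<And>t. a t \<le> \<alpha>"
  shows "(\<forall>t. integrable M (\<lambda>\<omega>. (norm (what (t + 1) \<omega> - wstar))\<^sup>2)) \<and>
    (\<forall>t. integrable M (\<lambda>\<omega>. (norm (w (t + 1) \<omega> - wstar))\<^sup>2)) \<and>
    (\<exists>r. r \<in> O(\<lambda>t. 1 / (real t * ln (real t))) \<and>
      (\<forall>t\<ge>1. (\<integral>\<omega>. (norm (what (t + 1) \<omega> - wstar))\<^sup>2 \<partial>M)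
        \<le> 4 * \<alpha>\<^sup>2 * real D * N / \<mu>\<^sup>2 * (1 / real t) + r t)) \<and>
    (\<exists>r. r \<in> O(\<lambda>t. 1 / (real t * ln (real t))) \<and>
      (\<forall>t\<ge>1. (\<integral>\<omega>. (norm (w (t + 1) \<omega> - wstar))\<^sup>2 \<partial>M)
        \<le> 4 * \<alpha>\<^sup>2 * real D * N / \<mu>\<^sup>2 * (1 / real t) + r t))"
proof -
  have alpha: "12 \<le> \<alpha>" using a_bounds[of 0] by linarith
  have c0: "0 < 2 * L * \<alpha> * real D / \<mu>"
    using L_pos alpha D_ge1 mu_pos by simp
  \<comment> \<open>The lower bound on the delay is positive, so the denominator is positive at
    \<open>t = 0\<close> as well.\<close>
  have den: "0 < \<mu> * (real t + 2 * real (\<tau> t))" for t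
    using tau_lower[of t] c0 mu_pos by (intro mult_pos_pos) auto
  have eta_lo: "12 / (\<mu> * (real t + 2 * real (\<tau> t))) \<le> \<eta> t" for t
    unfolding eta_def using a_bounds(1)[of t] den[of t] by (intro divide_right_mono) auto
  have eta_hi: "\<eta> t \<le> \<alpha> / (\<mu> * (real t + 2 * real (\<tau> t)))" for t
    unfolding eta_def using a_bounds(2)[of t] den[of t] by (intro divide_right_mono) auto
  have eta_nonneg: "0 \<le> \<eta> t" for t
    using eta_lo[of t] den[of t] by (smt (verit) divide_nonneg_pos)
  \<comment> \<open>The lower bound on the delay makes the denominator at least
    \<open>4 * L * \<alpha> * real D\<close>, uniformly in \<open>t\<close>.\<close>
  have eta_small: "\<eta> t \<le> 1 / (4 * L * real D)" for t
  proof -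
    have "4 * L * \<alpha> * real D \<le> \<mu> * (2 * real (\<tau> t))"
      using tau_lower[of t] mu_pos by (simp add: field_simps)
    also have "\<dots> \<le> \<mu> * (real t + 2 * real (\<tau> t))"
      using mu_pos by (intro mult_left_mono) auto
    finally have "\<alpha> / (\<mu> * (real t + 2 * real (\<tau> t))) \<le> \<alpha> / (4 * L * \<alpha> * real D)"
      using alpha L_pos D_ge1 den[of t] by (intro divide_left_mono) auto
    also have "\<dots> = 1 / (4 * L * real D)" using alpha by simp
    finally show ?thesis using eta_hi[of t] by simp
  qed
  have xi_meas: "\<xi> t \<in> measurable M P" for t
    using xi_iid(1) unfolding prob_space.indep_vars_def[OF prob_M] by auto
  interpret hogwild M P f F S D \<xi> u \<Sigma> w what w0 wstar \<tau> \<eta> \<mu> L N g d\<xi>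
  proof (intro hogwild.intro hogwild_axioms.intro)
    show "g = (\<lambda>v x. gradient (\<lambda>v'. f v' x) v)" by (simp add: g_def)
    show "d\<xi> = (\<lambda>x. num_filters D (card (grad_support (\<lambda>v. f v x))))" by (simp add: d\<xi>_def)
  qed (fact prob_M prob_P f_diff f_int F_def g_int g_unbiased mu_pos F_sc L_pos f_smooth f_convex
      minimizer N_fin N_def D_ge1 S_part S_meas xi_meas xi_iid(2) u_meas mask_meas xi_indep u_unif
      w_0 w_Suc consistent eta_nonneg eta_small)+
  \<comment> \<open>Half of the constant to be proved: the other half is lost when passing from
    \<open>write_err\<close> to \<open>read_err\<close>.\<close>
  define A where "A = 2 * \<alpha>\<^sup>2 * real D * N / \<mu>\<^sup>2"
  have A: "0 \<le> A" unfolding A_def using N_nonneg by simp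
  obtain C where C: "0 \<le> C" and bound: "\<forall>\<^sub>F t in sequentially.
      write_err t \<le> A / real t + C / (real t * ln (real t)) \<and> lag t \<le> C / (real t * ln (real t))"
    unfolding A_def using asymptotic_bounds[OF eta_lo eta_hi _ tau_upper] alpha by auto
  have 2: "2 * A = 4 * \<alpha>\<^sup>2 * real D * N / \<mu>\<^sup>2" by (simp add: A_def)
  \<comment> \<open>In \<open>read_err_le\<close>, twice the write error contributes
    \<open>2 * A\<close> and \<open>2 * C\<close>, and twice the lag another \<open>2 * C\<close>.
    The write error is weakened to the same bound.\<close>
  have "\<forall>\<^sub>F t in sequentially. write_err t \<le> 2 * A / real t + 4 * C / (real t * ln (real t)) \<and>
      read_err t \<le> 2 * A / real t + 4 * C / (real t * ln (real t))"
    using bound eventually_ge_at_top[of 2]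
  proof eventually_elim
    case (elim t)
    have "0 \<le> A / real t" "0 \<le> C / (real t * ln (real t))" using A C elim by auto
    moreover have "write_err t \<le> 2 * x + 4 * y \<and> read_err t \<le> 2 * x + 4 * y"
      if "0 \<le> x" "0 \<le> y" "write_err t \<le> x + y" "lag t \<le> y" for x y
      using that read_err_le[of t] by auto
    ultimately have "write_err t \<le> 2 * (A / real t) + 4 * (C / (real t * ln (real t))) \<and>
        read_err t \<le> 2 * (A / real t) + 4 * (C / (real t * ln (real t)))"
      using elim by blast
    then show ?case by simp
  qed
  then have "\<forall>\<^sub>F t in sequentially. write_err t \<le> 2 * A / real t + 4 * C / (real t * ln (real t))"
    and "\<forall>\<^sub>F t in sequentially. read_err t \<le> 2 * A / real t + 4 * C / (real t * ln (real t))"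
    by (auto elim: eventually_mono)
  then have "\<exists>r. r \<in> O(\<lambda>t. 1 / (real t * ln (real t))) \<and>
      (\<forall>t\<ge>1. write_err (t + 1) \<le> 2 * A * (1 / real t) + r t)"
    and "\<exists>r. r \<in> O(\<lambda>t. 1 / (real t * ln (real t))) \<and>
      (\<forall>t\<ge>1. read_err (t + 1) \<le> 2 * A * (1 / real t) + r t)"
    using C A bound_with_remainder[of "4 * C" "2 * A" write_err]
      bound_with_remainder[of "4 * C" "2 * A" read_err] by simp_all
  then show ?thesis
    using sq_w sq_what unfolding 2 write_err_def read_err_def square_integrable_def by blast
qed

end
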